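(* Let $X\in\Omega$. Let $N_1,N_2,\dots$ be the degenerate curls obtained by repeated application of ASW factorization to $X$. That is, $Y_0=X$, $N_k=N(\epsilon_1(Y_{k-1}),\dots,\epsilon_n(Y_{k-1}))$ and $Y_k=N_k^{-1}Y_{k-1}$. Then $$X=\prod_{k\ge1}N_k=\lim_{k\to\infty}N_1N_2\cdots N_k.$$
   Context: Elements of $GL_n(\mathbb R((t)))$ are identified with their unfoldings, the $\mathbb Z\times\mathbb Z$ matrices $X=(x_{i,j})$ with $x_{i+n,j+n}=x_{i,j}$ and $a_{ij}(t)=\sum_kx_{i,j+kn}t^k$. $U$ denotes the upper triangular unipotent elements, and $U_{\ge0}$ those with all finite minors nonnegative. For $i\in\mathbb Z/n\mathbb Z$, $e_i(a)$ is the identity except for entries $a$ at positions $(kn+i,kn+i+1)$. For an infinite word $\mathbf i$ and $\mathbf a\in\ell^1_{>0}$ (positive sequences with finite sum), $e_{\mathbf i}(\mathbf a)=\lim_ke_{i_1}(a_1)\cdots e_{i_k}(a_k)$. $\Omega$ is the union of the images of $e_{\mathbf i}$ over infinite reduced words $\mathbf i$ (words all of whose prefixes $s_{i_1}\cdots s_{i_k}$ have length $k$ in the affine symmetric group). Whirls and curls: the whirl $M(a_1,\dots,a_n)\in U$ has $m_{i,i}=1$, $m_{i,i+1}=a_i$ (indices mod $n$) and all other entries $0$. For $X\in U$, $X^c$ is defined by $x_{i,j}\mapsto(-1)^{|i-j|}x_{i,j}$, and $X^{-c}=(X^c)^{-1}$. The curl is $N(a_1,\dots,a_n)=M(a_1,\dots,a_n)^{-c}$.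 It is degenerate if some $a_i=0$. The numbers $\epsilon_i$ for $X\in U_{\ge0}$: - if $X$ is infinitely supported, $\epsilon_i(X)=\lim_{j\to\infty}x_{i,j}/x_{i+1,j}$; - if $X$ is finitely supported, $\epsilon_i(X)=x_{i,j}/x_{i+1,j}$, where $j$ is maximal with $x_{i+1,j}\ne0$. ASW factorization is the factorization $X=N(\epsilon_1(X),\dots,\epsilon_n(X))\,Y$. It is known that $Y\in U_{\ge0}$, and that $N(\epsilon(X))$ is degenerate for $X\in\Omega$. *)

theory Defs
  imports Complex_Main "HOL-Library.Groups_Big_Fun" "HOL-Algebra.Group"
begin

type_synonym loop_mat = "int \<Rightarrow> int \<Rightarrow> real"

text \<open>
  The monoid of \<open>n \<times> n\<close> matrices over the real formal Laurent series, in unfolded form: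
  \<open>a\<^sub>i\<^sub>j(t) = \<Sum>\<^sub>k x\<^bsub>i,j+kn\<^esub> t\<^sup>k\<close>. By periodicity, all entries \<open>a\<^sub>i\<^sub>j\<close> being Laurent series means that
  the diagonals far enough below the main one vanish. For such matrices the sum
  defining an entry of a product has only finitely many nonzero terms, which is what
  \<open>Sum_any\<close> sums over. The group of units is \<open>GL\<^sub>n(\<real>((t)))\<close>.
\<close>

definition loop_mats :: "nat \<Rightarrow> loop_mat monoid" where
  "loop_mats n = \<lparr>
     carrier = {X. (\<forall>i j. X (i + int n) (j + int n) = X i j) \<and>
                   (\<exists>d. \<forall>i j. j - i < d \<longrightarrow> X i j = 0)},
     mult = (\<lambda>X Y i j. Sum_any (\<lambda>k. X i k * Y k j)),
     one = (\<lambda>i j. if i = j then 1 else 0)\<rparr>"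

definition list_prod :: "nat \<Rightarrow> loop_mat list \<Rightarrow> loop_mat" where
  "list_prod n Xs = foldr (mult (loop_mats n)) Xs (one (loop_mats n))"

definition entrywise_lim :: "(nat \<Rightarrow> loop_mat) \<Rightarrow> loop_mat \<Rightarrow> bool" where
  "entrywise_lim S X \<longleftrightarrow> (\<forall>i j. (\<lambda>k. S k i j) \<longlonglongrightarrow> X i j)"


text \<open>
  Elements of \<open>\<int>/n\<int>\<close> are represented by arbitrary integers; the definitions below
  depend on \<open>i\<close> only modulo \<open>n\<close>.
\<close>

definition chevalley :: "nat \<Rightarrow> int \<Rightarrow> real \<Rightarrow> loop_mat" where
  "chevalley n i a = (\<lambda>p q. if p = q then 1
     else if q = p + 1 \<and> p mod int n = i mod int n then a else 0)"

text \<open>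
  The affine symmetric group (\<open>n \<ge> 2\<close>) is realised as the group of permutations of
  \<open>\<int>\<close> generated by the simple reflections \<open>s\<^sub>i\<close>, which swap \<open>kn + i\<close> and \<open>kn + i + 1\<close>
  for all \<open>k\<close>.
\<close>

definition simple_refl :: "nat \<Rightarrow> int \<Rightarrow> int \<Rightarrow> int" where
  "simple_refl n i = (\<lambda>j. if j mod int n = i mod int n then j + 1
     else if j mod int n = (i + 1) mod int n then j - 1 else j)"

definition word_perm :: "nat \<Rightarrow> int list \<Rightarrow> int \<Rightarrow> int" where
  "word_perm n ws = foldr (\<lambda>i f. simple_refl n i \<circ> f) ws id"

definition affine_length :: "nat \<Rightarrow> (int \<Rightarrow> int) \<Rightarrow> nat" where
  "affine_length n f = (LEAST k. \<exists>ws. length ws = k \<and> word_perm n ws = f)"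

text \<open>Sequences are indexed from 1; their value at 0 is irrelevant.\<close>

definition infinite_reduced_word :: "nat \<Rightarrow> (nat \<Rightarrow> int) \<Rightarrow> bool" where
  "infinite_reduced_word n w \<longleftrightarrow>
     (\<forall>k. affine_length n (word_perm n (map w [1..<Suc k])) = k)"

definition l1_pos :: "(nat \<Rightarrow> real) set" where
  "l1_pos = {a. (\<forall>k\<ge>1. a k > 0) \<and> summable a}"

definition Omega :: "nat \<Rightarrow> loop_mat set" where
  "Omega n = {X. \<exists>w a. infinite_reduced_word n w \<and> a \<in> l1_pos \<and>
     entrywise_lim (\<lambda>k. list_prod n (map (\<lambda>m. chevalley n (w m) (a m)) [1..<Suc k])) X}"


text \<open>
  A whirl depends on \<open>a 1, \<dots>, a n\<close> only: \<open>(i - 1) mod n + 1\<close> is the representative of \<open>i\<close>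
  in \<open>{1..n}\<close>.
\<close>

definition whirl :: "nat \<Rightarrow> (int \<Rightarrow> real) \<Rightarrow> loop_mat" where
  "whirl n a = (\<lambda>i j. if j = i then 1
     else if j = i + 1 then a ((i - 1) mod int n + 1) else 0)"

definition sign_conj :: "loop_mat \<Rightarrow> loop_mat" where
  "sign_conj X = (\<lambda>i j. (- 1) ^ nat \<bar>i - j\<bar> * X i j)"

definition curl :: "nat \<Rightarrow> (int \<Rightarrow> real) \<Rightarrow> loop_mat" where
  "curl n a = inv\<^bsub>loop_mats n\<^esub> (sign_conj (whirl n a))"

definition finitely_supported :: "loop_mat \<Rightarrow> bool" where
  "finitely_supported X \<longleftrightarrow> (\<exists>d. \<forall>i j. j - i > d \<longrightarrow> X i j = 0)"

text \<open>
  \<open>asw_eps X i\<close> is meant for totally nonnegative, upper triangular unipotent \<open>X\<close>, where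
  the limit and the maximal index exist.
\<close>

definition asw_eps :: "loop_mat \<Rightarrow> int \<Rightarrow> real" where
  "asw_eps X i =
     (if finitely_supported X
      then let j = (GREATEST j. X (i + 1) j \<noteq> 0) in X i j / X (i + 1) j
      else Lim at_top (\<lambda>j. X i j / X (i + 1) j))"

end

theory Submission
  imports Defs
begin

text \<open>
  Let \<open>\<Phi>(X) = N(\<epsilon>(X))\<^sup>-\<^sup>1 X\<close>. If \<open>X = e\<^sub>i(a) X'\<close>, comparing the limits defining \<open>\<epsilon>(X)\<close> and \<open>\<epsilon>(X')\<close>
  gives \<open>\<Phi>(X) = e\<^bsub>i-1\<^esub>(b) \<Phi>(X')\<close> with \<open>b = a \<epsilon>\<^bsub>i-1\<^esub>(X') / (\<epsilon>\<^sub>i(X') + a)\<close>. Thus \<open>\<Phi>\<close> maps an infinite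
  product of Chevalley generators to another one, and commutes with passing to tails of the
  product. Moreover \<open>0 \<le> b \<le> \<epsilon>\<^bsub>i-1\<^esub>(X')\<close>, which yields the entrywise inequality \<open>\<Phi>(X) \<le> X'\<close>.
  Hence \<open>Y\<^sub>k = \<Phi>\<^sup>k(X)\<close> is bounded entrywise by the tail of \<open>X\<close> after \<open>k\<close> factors, which tends to the
  identity. As \<open>X = N\<^sub>1 \<cdots> N\<^sub>k Y\<^sub>k\<close> with all factors nonnegative and unipotent, the products
  \<open>N\<^sub>1 \<cdots> N\<^sub>k\<close> tend to \<open>X\<close>.

  Since \<open>N(\<epsilon>(X))\<close> is degenerate, \<open>\<Phi>(X)\<close> is again infinitely supported, so that only the limit case
  in the definition of \<open>\<epsilon>\<close> occurs.
\<close>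

subsection \<open>The monoid of periodic matrices\<close>

lemma loop_mats_carrier_iff:
  "X \<in> carrier (loop_mats n) \<longleftrightarrow> (\<forall>i j. X (i + int n) (j + int n) = X i j) \<and>
     (\<exists>d. \<forall>i j. j - i < d \<longrightarrow> X i j = 0)"
  by (simp add: loop_mats_def)

lemma loop_mats_one: "\<one>\<^bsub>loop_mats n\<^esub> = (\<lambda>i j. if i = j then 1 else 0)"
  by (simp add: loop_mats_def)

lemma loop_mats_mult_eq_sum:
  assumes "\<forall>i j. j - i < d \<longrightarrow> X i j = 0" "\<forall>i j. j - i < e \<longrightarrow> Y i j = 0"
    and "{i + d..j - e} \<subseteq> A" "finite A"
  shows "(X \<otimes>\<^bsub>loop_mats n\<^esub> Y) i j = (\<Sum>k\<in>A. X i k * Y k j)"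
proof -
  have "{k. X i k * Y k j \<noteq> 0} \<subseteq> A"
  proof (rule subset_trans[OF _ assms(3)], rule subsetI)
    fix k assume "k \<in> {k. X i k * Y k j \<noteq> 0}"
    hence "X i k \<noteq> 0" "Y k j \<noteq> 0" by auto
    hence "\<not> k - i < d" "\<not> j - k < e" using assms(1,2) by blast+
    thus "k \<in> {i + d..j - e}" by auto
  qed
  from Sum_any.expand_superset[OF assms(4) this] show ?thesis
    by (simp add: loop_mats_def)
qed

lemma loop_mats_mult_closed:
  assumes "X \<in> carrier (loop_mats n)" "Y \<in> carrier (loop_mats n)"
  shows "X \<otimes>\<^bsub>loop_mats n\<^esub> Y \<in> carrier (loop_mats n)"
proof -
  obtain d where d: "\<forall>i j. j - i < d \<longrightarrow> X i j = 0"
    using assms(1) by (auto simp: loop_mats_carrier_iff)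
  obtain e where e: "\<forall>i j. j - i < e \<longrightarrow> Y i j = 0"
    using assms(2) by (auto simp: loop_mats_carrier_iff)
  have prod: "(X \<otimes>\<^bsub>loop_mats n\<^esub> Y) i j = (\<Sum>k\<in>{i + d..j - e}. X i k * Y k j)" for i j
    by (rule loop_mats_mult_eq_sum[OF d e]) auto
  have "(X \<otimes>\<^bsub>loop_mats n\<^esub> Y) (i + int n) (j + int n) = (X \<otimes>\<^bsub>loop_mats n\<^esub> Y) i j" for i j
    unfolding prod
    by (rule sum.reindex_bij_witness[where i = "\<lambda>k. k + int n" and j = "\<lambda>k. k - int n"])
      (use assms in \<open>auto simp: loop_mats_carrier_iff\<close>,
       metis diff_add_cancel)
  moreover have "\<forall>i j. j - i < d + e \<longrightarrow> (X \<otimes>\<^bsub>loop_mats n\<^esub> Y) i j = 0"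
    unfolding prod by auto
  ultimately show ?thesis unfolding loop_mats_carrier_iff by blast
qed

lemma loop_mats_mult_assoc:
  assumes "X \<in> carrier (loop_mats n)" "Y \<in> carrier (loop_mats n)" "Z \<in> carrier (loop_mats n)"
  shows "(X \<otimes>\<^bsub>loop_mats n\<^esub> Y) \<otimes>\<^bsub>loop_mats n\<^esub> Z = X \<otimes>\<^bsub>loop_mats n\<^esub> (Y \<otimes>\<^bsub>loop_mats n\<^esub> Z)"
proof (intro ext)
  fix i j
  obtain d where d: "\<forall>i j. j - i < d \<longrightarrow> X i j = 0"
    using assms(1) by (auto simp: loop_mats_carrier_iff)
  obtain e where e: "\<forall>i j. j - i < e \<longrightarrow> Y i j = 0"
    using assms(2) by (auto simp: loop_mats_carrier_iff)
  obtain f where f: "\<forall>i j. j - i < f \<longrightarrow> Z i j = 0"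
    using assms(3) by (auto simp: loop_mats_carrier_iff)
  have de: "\<forall>i j. j - i < d + e \<longrightarrow> (X \<otimes>\<^bsub>loop_mats n\<^esub> Y) i j = 0"
    by (auto simp: loop_mats_mult_eq_sum[OF d e order_refl])
  have ef: "\<forall>i j. j - i < e + f \<longrightarrow> (Y \<otimes>\<^bsub>loop_mats n\<^esub> Z) i j = 0"
    by (auto simp: loop_mats_mult_eq_sum[OF e f order_refl])
  \<comment> \<open>These ranges contain the supports of the inner sums for all outer indices at
    once, so the double sum runs over a rectangle and can be swapped.\<close>
  define K where "K = {i + d + e..j - f}"
  define L where "L = {i + d..j - e - f}"
  have "((X \<otimes>\<^bsub>loop_mats n\<^esub> Y) \<otimes>\<^bsub>loop_mats n\<^esub> Z) i j = (\<Sum>k\<in>K. (X \<otimes>\<^bsub>loop_mats n\<^esub> Y) i k * Z k j)"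
    by (rule loop_mats_mult_eq_sum[OF de f]) (auto simp: K_def)
  also have "\<dots> = (\<Sum>k\<in>K. (\<Sum>l\<in>L. X i l * Y l k) * Z k j)"
    by (intro sum.cong refl arg_cong2[where f = "(*)"] loop_mats_mult_eq_sum[OF d e])
      (auto simp: K_def L_def)
  also have "\<dots> = (\<Sum>l\<in>L. X i l * (\<Sum>k\<in>K. Y l k * Z k j))"
    unfolding sum_distrib_left sum_distrib_right
    by (subst sum.swap) (simp add: mult.assoc)
  also have "\<dots> = (\<Sum>l\<in>L. X i l * (Y \<otimes>\<^bsub>loop_mats n\<^esub> Z) l j)"
    by (intro sum.cong refl arg_cong2[where f = "(*)"] loop_mats_mult_eq_sum[OF e f, symmetric])
      (auto simp: K_def L_def)
  also have "\<dots> = (X \<otimes>\<^bsub>loop_mats n\<^esub> (Y \<otimes>\<^bsub>loop_mats n\<^esub> Z)) i j"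
    by (rule loop_mats_mult_eq_sum[OF d ef, symmetric]) (auto simp: L_def)
  finally show "((X \<otimes>\<^bsub>loop_mats n\<^esub> Y) \<otimes>\<^bsub>loop_mats n\<^esub> Z) i j = \<dots>" .
qed

lemma monoid_loop_mats: "monoid (loop_mats n)"
proof (rule monoidI)
  have z: "\<forall>i j. j - i < 0 \<longrightarrow> \<one>\<^bsub>loop_mats n\<^esub> i j = 0"
    by (auto simp: loop_mats_one)
  show "\<one>\<^bsub>loop_mats n\<^esub> \<in> carrier (loop_mats n)"
    unfolding loop_mats_carrier_iff using z by (auto simp: loop_mats_one)
  fix X assume X: "X \<in> carrier (loop_mats n)"
  then obtain d where d: "\<forall>i j. j - i < d \<longrightarrow> X i j = 0"
    by (auto simp: loop_mats_carrier_iff)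
  show "\<one>\<^bsub>loop_mats n\<^esub> \<otimes>\<^bsub>loop_mats n\<^esub> X = X"
  proof (intro ext)
    fix i j
    \<comment> \<open>The index \<open>i\<close> is added because the range misses it when
      \<open>j - i < d\<close>; in that case the extra term \<open>X i j\<close> is 0.\<close>
    have "(\<one>\<^bsub>loop_mats n\<^esub> \<otimes>\<^bsub>loop_mats n\<^esub> X) i j =
      (\<Sum>k\<in>insert i {i + 0..j - d}. \<one>\<^bsub>loop_mats n\<^esub> i k * X k j)"
      by (rule loop_mats_mult_eq_sum[OF z d]) auto
    also have "\<dots> = (\<Sum>k\<in>insert i {i + 0..j - d}. if i = k then X k j else 0)"
      by (intro sum.cong) (auto simp: loop_mats_one)
    finally show "(\<one>\<^bsub>loop_mats n\<^esub> \<otimes>\<^bsub>loop_mats n\<^esub> X) i j = X i j" by simp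
  qed
  show "X \<otimes>\<^bsub>loop_mats n\<^esub> \<one>\<^bsub>loop_mats n\<^esub> = X"
  proof (intro ext)
    fix i j
    have "(X \<otimes>\<^bsub>loop_mats n\<^esub> \<one>\<^bsub>loop_mats n\<^esub>) i j =
      (\<Sum>k\<in>insert j {i + d..j - 0}. X i k * \<one>\<^bsub>loop_mats n\<^esub> k j)"
      by (rule loop_mats_mult_eq_sum[OF d z]) auto
    also have "\<dots> = (\<Sum>k\<in>insert j {i + d..j - 0}. if j = k then X i k else 0)"
      by (intro sum.cong) (auto simp: loop_mats_one)
    finally show "(X \<otimes>\<^bsub>loop_mats n\<^esub> \<one>\<^bsub>loop_mats n\<^esub>) i j = X i j" by simp
  qed
qed (fact loop_mats_mult_closed loop_mats_mult_assoc)+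

lemma loop_mats_periodic:
  assumes "X \<in> carrier (loop_mats n)"
  shows "X (i + k * int n) (j + k * int n) = X i j"
proof (induction k rule: int_induct[where k = 0])
  case base show ?case by simp
next
  case (step1 k)
  have "X (i + k * int n + int n) (j + k * int n + int n) = X (i + k * int n) (j + k * int n)"
    using assms unfolding loop_mats_carrier_iff by blast
  with step1 show ?case by (simp add: algebra_simps)
next
  case (step2 k)
  have "X (i + (k - 1) * int n + int n) (j + (k - 1) * int n + int n)
      = X (i + (k - 1) * int n) (j + (k - 1) * int n)"
    using assms unfolding loop_mats_carrier_iff by blast
  with step2 show ?case by (simp add: algebra_simps)
qed

lemma list_prod_Nil: "list_prod n [] = \<one>\<^bsub>loop_mats n\<^esub>"
  and list_prod_Cons: "list_prod n (X # Xs) = X \<otimes>\<^bsub>loop_mats n\<^esub> list_prod n Xs"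
  by (simp_all add: list_prod_def)

lemma list_prod_closed:
  "set Xs \<subseteq> carrier (loop_mats n) \<Longrightarrow> list_prod n Xs \<in> carrier (loop_mats n)"
  by (induction Xs)
    (simp_all add: list_prod_Nil list_prod_Cons monoid.one_closed[OF monoid_loop_mats]
      loop_mats_mult_closed)

lemma list_prod_append:
  assumes "set Xs \<subseteq> carrier (loop_mats n)" "set Ys \<subseteq> carrier (loop_mats n)"
  shows "list_prod n (Xs @ Ys) = list_prod n Xs \<otimes>\<^bsub>loop_mats n\<^esub> list_prod n Ys"
  using assms
  by (induction Xs)
    (simp_all add: list_prod_Nil list_prod_Cons monoid.l_one[OF monoid_loop_mats]
      loop_mats_mult_assoc list_prod_closed)

subsection \<open>Nonnegative unipotent matrices\<close>

text \<open>A class closed under products in which every product dominates both factors entrywise: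
  the summands that meet a unit diagonal entry already give the entries of the factors.\<close>

definition unitri_nonneg :: "nat \<Rightarrow> loop_mat set" where
  "unitri_nonneg n = {X. (\<forall>i j. X (i + int n) (j + int n) = X i j) \<and> (\<forall>i. X i i = 1) \<and>
     (\<forall>i j. j < i \<longrightarrow> X i j = 0) \<and> (\<forall>i j. 0 \<le> X i j)}"

lemma unitri_nonneg_carrier: "X \<in> unitri_nonneg n \<Longrightarrow> X \<in> carrier (loop_mats n)"
  unfolding unitri_nonneg_def loop_mats_carrier_iff by (auto intro!: exI[of _ 0])

lemma unitri_nonnegD:
  assumes "X \<in> unitri_nonneg n"
  shows "X i i = 1" "j < i \<Longrightarrow> X i j = 0" "0 \<le> X i j"
  using assms by (auto simp: unitri_nonneg_def)

lemma unitri_mult: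
  assumes "X \<in> unitri_nonneg n" "Y \<in> unitri_nonneg n"
  shows "(X \<otimes>\<^bsub>loop_mats n\<^esub> Y) i j = (\<Sum>k\<in>{i..j}. X i k * Y k j)"
  by (rule loop_mats_mult_eq_sum[where d = 0 and e = 0])
    (use assms in \<open>auto simp: unitri_nonneg_def\<close>)

lemma unitri_nonneg_one: "\<one>\<^bsub>loop_mats n\<^esub> \<in> unitri_nonneg n"
  by (auto simp: unitri_nonneg_def loop_mats_one)

lemma unitri_nonneg_mult:
  assumes "X \<in> unitri_nonneg n" "Y \<in> unitri_nonneg n"
  shows "X \<otimes>\<^bsub>loop_mats n\<^esub> Y \<in> unitri_nonneg n"
proof -
  have "X \<otimes>\<^bsub>loop_mats n\<^esub> Y \<in> carrier (loop_mats n)"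
    using assms by (intro loop_mats_mult_closed unitri_nonneg_carrier)
  hence "\<forall>i j. (X \<otimes>\<^bsub>loop_mats n\<^esub> Y) (i + int n) (j + int n) = (X \<otimes>\<^bsub>loop_mats n\<^esub> Y) i j"
    by (simp add: loop_mats_carrier_iff)
  thus ?thesis using assms
    by (auto simp: unitri_nonneg_def unitri_mult[OF assms] intro!: sum_nonneg)
qed

lemma list_prod_unitri_nonneg:
  "set Xs \<subseteq> unitri_nonneg n \<Longrightarrow> list_prod n Xs \<in> unitri_nonneg n"
  by (induction Xs)
    (simp_all add: list_prod_Nil list_prod_Cons unitri_nonneg_one unitri_nonneg_mult)

lemma unitri_mult_ge_left:
  assumes X: "X \<in> unitri_nonneg n" and Y: "Y \<in> unitri_nonneg n"
  shows "X i j \<le> (X \<otimes>\<^bsub>loop_mats n\<^esub> Y) i j"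
proof (cases "i \<le> j")
  case True
  have "X i j * Y j j \<le> (\<Sum>k\<in>{i..j}. X i k * Y k j)"
    by (rule member_le_sum) (use True in \<open>auto simp: unitri_nonnegD[OF X] unitri_nonnegD[OF Y]\<close>)
  thus ?thesis by (simp add: unitri_mult[OF X Y] unitri_nonnegD[OF Y])
next
  case False
  thus ?thesis
    using unitri_nonnegD[OF X] unitri_nonnegD[OF unitri_nonneg_mult[OF X Y]] by simp
qed

lemma unitri_mult_ge_right:
  assumes X: "X \<in> unitri_nonneg n" and Y: "Y \<in> unitri_nonneg n"
  shows "Y i j \<le> (X \<otimes>\<^bsub>loop_mats n\<^esub> Y) i j"
proof (cases "i \<le> j")
  case True
  have "X i i * Y i j \<le> (\<Sum>k\<in>{i..j}. X i k * Y k j)"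
    by (rule member_le_sum) (use True in \<open>auto simp: unitri_nonnegD[OF X] unitri_nonnegD[OF Y]\<close>)
  thus ?thesis by (simp add: unitri_mult[OF X Y] unitri_nonnegD[OF X])
next
  case False
  thus ?thesis
    using unitri_nonnegD[OF Y] unitri_nonnegD[OF unitri_nonneg_mult[OF X Y]] by simp
qed

text \<open>For \<open>i < j\<close> the summands \<open>k = i\<close> and \<open>k = j\<close> are
  distinct and equal \<open>Y i j\<close> and \<open>X i j\<close>.\<close>

lemma unitri_mult_ge_sum:
  assumes X: "X \<in> unitri_nonneg n" and Y: "Y \<in> unitri_nonneg n" and "i < j"
  shows "X i j + Y i j \<le> (X \<otimes>\<^bsub>loop_mats n\<^esub> Y) i j"
proof -
  have "(\<Sum>k\<in>{i, j}. X i k * Y k j) \<le> (\<Sum>k\<in>{i..j}. X i k * Y k j)"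
    by (rule sum_mono2) (use \<open>i < j\<close> in \<open>auto simp: unitri_nonnegD[OF X] unitri_nonnegD[OF Y]\<close>)
  thus ?thesis using \<open>i < j\<close>
    by (simp add: unitri_mult[OF X Y] unitri_nonnegD[OF X] unitri_nonnegD[OF Y])
qed

text \<open>Apart from \<open>P k i j\<close>, the entry \<open>X i j\<close> consists of the
  summands \<open>P k i l * Y k l j\<close> with \<open>i \<le> l < j\<close>. They tend to 0, since
  \<open>P k i l\<close> is bounded by \<open>X i l\<close> and \<open>Y k\<close> tends to the
  identity.\<close>

lemma entrywise_lim_left_factor:
  assumes P: "\<And>k. P k \<in> unitri_nonneg n" and Y: "\<And>k. Y k \<in> unitri_nonneg n"
    and X: "\<And>k. X = P k \<otimes>\<^bsub>loop_mats n\<^esub> Y k"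
    and lim: "entrywise_lim Y \<one>\<^bsub>loop_mats n\<^esub>"
  shows "entrywise_lim P X"
  unfolding entrywise_lim_def
proof (intro allI)
  fix i j
  have XU: "X \<in> unitri_nonneg n" using unitri_nonneg_mult[OF P Y] X by metis
  have PX: "P k i l \<le> X i l" for k l
    using unitri_mult_ge_left[OF P Y] X by metis
  show "(\<lambda>k. P k i j) \<longlonglongrightarrow> X i j"
  proof (cases "i \<le> j")
    case False
    thus ?thesis by (simp add: unitri_nonnegD[OF P] unitri_nonnegD[OF XU])
  next
    case True
    have eq: "X i j = P k i j + (\<Sum>l\<in>{i..<j}. P k i l * Y k l j)" for k
    proof -
      have "X i j = (\<Sum>l\<in>{i..j}. P k i l * Y k l j)"
        using X[of k] unitri_mult[OF P Y] by metis
      moreover have "{i..j} = insert j {i..<j}" using True by auto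
      ultimately show ?thesis by (simp add: unitri_nonnegD[OF Y])
    qed
    have "(\<lambda>k. \<Sum>l\<in>{i..<j}. P k i l * Y k l j) \<longlonglongrightarrow> (\<Sum>l\<in>{i..<j}. 0)"
    proof (intro tendsto_sum)
      fix l assume l: "l \<in> {i..<j}"
      hence "(\<lambda>k. Y k l j) \<longlonglongrightarrow> 0"
        using lim[unfolded entrywise_lim_def, rule_format, of l j] by (simp add: loop_mats_one)
      hence "(\<lambda>k. X i l * Y k l j) \<longlonglongrightarrow> 0" by (rule tendsto_mult_right_zero)
      thus "(\<lambda>k. P k i l * Y k l j) \<longlonglongrightarrow> 0"
        by (rule tendsto_sandwich[OF _ _ tendsto_const, rotated 2])
          (simp_all add: unitri_nonnegD[OF P] unitri_nonnegD[OF Y] PX mult_right_mono)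
    qed
    hence "(\<lambda>k. X i j - (\<Sum>l\<in>{i..<j}. P k i l * Y k l j)) \<longlonglongrightarrow> X i j - 0"
      by (intro tendsto_diff tendsto_const) simp
    moreover have "(\<lambda>k. X i j - (\<Sum>l\<in>{i..<j}. P k i l * Y k l j)) = (\<lambda>k. P k i j)"
      using eq by (intro ext) (metis add_diff_cancel_right')
    ultimately show ?thesis by simp
  qed
qed

text \<open>The 2 by 2 part of total nonnegativity, which makes ratios of consecutive rows monotone.
  Coinciding rows or columns are allowed, as both sides then agree.\<close>

definition minors2_nonneg :: "loop_mat \<Rightarrow> bool" where
  "minors2_nonneg X \<longleftrightarrow>
     (\<forall>p p' q q'. p \<le> p' \<longrightarrow> q \<le> q' \<longrightarrow> X p q' * X p' q \<le> X p q * X p' q')"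

lemma minors2_nonnegD:
  "minors2_nonneg X \<Longrightarrow> p \<le> p' \<Longrightarrow> q \<le> q' \<Longrightarrow> X p q' * X p' q \<le> X p q * X p' q'"
  by (simp add: minors2_nonneg_def)

lemma minors2_nonneg_lim:
  assumes "entrywise_lim S X" "\<And>k. minors2_nonneg (S k)"
  shows "minors2_nonneg X"
  unfolding minors2_nonneg_def
proof (intro allI impI)
  fix p p' q q' :: int assume "p \<le> p'" "q \<le> q'"
  show "X p q' * X p' q \<le> X p q * X p' q'"
    by (rule LIMSEQ_le[of "\<lambda>k. S k p q' * S k p' q" _ "\<lambda>k. S k p q * S k p' q'"])
      (use assms \<open>p \<le> p'\<close> \<open>q \<le> q'\<close> in \<open>auto intro!: tendsto_mult minors2_nonnegD
        simp: entrywise_lim_def\<close>)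
qed

lemma chevalley_mult:
  assumes "X \<in> carrier (loop_mats n)"
  shows "(chevalley n i a \<otimes>\<^bsub>loop_mats n\<^esub> X) p q =
    X p q + (if p mod int n = i mod int n then a * X (p + 1) q else 0)"
proof -
  obtain d where d: "\<forall>i j. j - i < d \<longrightarrow> X i j = 0"
    using assms by (auto simp: loop_mats_carrier_iff)
  have "(chevalley n i a \<otimes>\<^bsub>loop_mats n\<^esub> X) p q =
     (\<Sum>k\<in>{p, p + 1} \<union> {p + 0..q - d}. chevalley n i a p k * X k q)"
    by (rule loop_mats_mult_eq_sum[where d = 0, OF _ d]) (auto simp: chevalley_def)
  also have "\<dots> = (\<Sum>k\<in>{p, p + 1}. chevalley n i a p k * X k q)"
    by (rule sum.mono_neutral_right) (auto simp: chevalley_def)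
  finally show ?thesis by (simp add: chevalley_def)
qed

lemma chevalley_unitri_nonneg: "a \<ge> 0 \<Longrightarrow> chevalley n i a \<in> unitri_nonneg n"
  by (auto simp: unitri_nonneg_def chevalley_def)

text \<open>The generator adds nonnegative multiples of row \<open>p + 1\<close> to row
  \<open>p\<close>, so each new minor expands bilinearly into four old ones with nonnegative
  coefficients.\<close>

lemma minors2_nonneg_chevalley_mult:
  assumes a: "a \<ge> 0" and "X \<in> carrier (loop_mats n)" and minors: "minors2_nonneg X"
  shows "minors2_nonneg (chevalley n i a \<otimes>\<^bsub>loop_mats n\<^esub> X)"
  unfolding minors2_nonneg_def chevalley_mult[OF assms(2)]
proof (intro allI impI)
  fix p p' q q' :: int assume le: "p \<le> p'" "q \<le> q'"
  define c where "c = (if p mod int n = i mod int n then a else 0)"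
  define c' where "c' = (if p' mod int n = i mod int n then a else 0)"
  have c: "c \<ge> 0" "c' \<ge> 0" using a by (auto simp: c_def c'_def)
  have D: "r \<le> r' \<Longrightarrow> 0 \<le> X r q * X r' q' - X r q' * X r' q" for r r'
    using minors2_nonnegD[OF minors _ le(2)] by simp
  have "(X p q' + c * X (p + 1) q') * (X p' q + c' * X (p' + 1) q)
    \<le> (X p q + c * X (p + 1) q) * (X p' q' + c' * X (p' + 1) q')"
  \<comment> \<open>The expansion needs \<open>p + 1 \<le> p'\<close>; for \<open>p = p'\<close> the
    two rows coincide and both sides are equal.\<close>
  proof (cases "p = p'")
    case True
    thus ?thesis by (simp add: c_def c'_def mult.commute)
  next
    case False
    have "0 \<le> (X p q * X p' q' - X p q' * X p' q)
      + c * (X (p + 1) q * X p' q' - X (p + 1) q' * X p' q)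
      + c' * (X p q * X (p' + 1) q' - X p q' * X (p' + 1) q)
      + (c * c') * (X (p + 1) q * X (p' + 1) q' - X (p + 1) q' * X (p' + 1) q)"
      by (intro add_nonneg_nonneg mult_nonneg_nonneg D c) (use le False in auto)
    thus ?thesis by (simp add: algebra_simps)
  qed
  thus "(X p q' + (if p mod int n = i mod int n then a * X (p + 1) q' else 0)) *
       (X p' q + (if p' mod int n = i mod int n then a * X (p' + 1) q else 0))
       \<le> (X p q + (if p mod int n = i mod int n then a * X (p + 1) q else 0)) *
          (X p' q' + (if p' mod int n = i mod int n then a * X (p' + 1) q' else 0))"
    by (simp add: c_def c'_def split: if_splits)
qed

lemma minors2_nonneg_one: "minors2_nonneg \<one>\<^bsub>loop_mats n\<^esub>"
  by (auto simp: minors2_nonneg_def loop_mats_one)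

lemma minors2_nonneg_chevalley_prod:
  assumes "\<And>l. l \<in> set ls \<Longrightarrow> a l \<ge> 0"
  shows "minors2_nonneg (list_prod n (map (\<lambda>l. chevalley n (w l) (a l)) ls))"
  using assms
proof (induction ls)
  case Nil
  show ?case by (simp add: list_prod_Nil minors2_nonneg_one)
next
  case (Cons l ls)
  have "list_prod n (map (\<lambda>l. chevalley n (w l) (a l)) ls) \<in> unitri_nonneg n"
    by (rule list_prod_unitri_nonneg) (use Cons.prems in \<open>auto intro!: chevalley_unitri_nonneg\<close>)
  thus ?case using Cons
    by (auto simp: list_prod_Cons intro!: minors2_nonneg_chevalley_mult unitri_nonneg_carrier)
qed

subsection \<open>The numbers \<open>\<epsilon>\<^sub>i\<close>\<close>

lemma antimono_nonneg_tendsto_at_top: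
  fixes f :: "int \<Rightarrow> real"
  assumes anti: "\<And>j k. c \<le> j \<Longrightarrow> j \<le> k \<Longrightarrow> f k \<le> f j" and nonneg: "\<And>j. c \<le> j \<Longrightarrow> 0 \<le> f j"
  shows "\<exists>L. (f \<longlongrightarrow> L) at_top"
proof -
  define L where "L = Inf (f ` {c..})"
  have bdd: "bdd_below (f ` {c..})" using nonneg by (auto intro!: bdd_belowI[of _ 0])
  have "(f \<longlongrightarrow> L) at_top"
  proof (rule order_tendstoI)
    fix x assume "x < L"
    moreover have "L \<le> f j" if "c \<le> j" for j
      unfolding L_def by (rule cInf_lower) (use bdd that in auto)
    ultimately have "\<forall>j\<ge>c. x < f j" by (meson less_le_trans)
    thus "eventually (\<lambda>j. x < f j) at_top"
      unfolding eventually_at_top_linorder by blast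
  next
    fix x assume "L < x"
    then obtain j where j: "c \<le> j" "f j < x"
      unfolding L_def by (subst (asm) cInf_less_iff) (use bdd in auto)
    hence "\<forall>k\<ge>j. f k < x" using anti by (meson le_less_trans)
    thus "eventually (\<lambda>j. f j < x) at_top"
      unfolding eventually_at_top_linorder by blast
  qed
  thus ?thesis ..
qed

definition tnn2_infinite :: "nat \<Rightarrow> loop_mat set" where
  "tnn2_infinite n = {X \<in> unitri_nonneg n. minors2_nonneg X \<and> \<not> finitely_supported X}"

lemma tnn2_infiniteD:
  assumes "X \<in> tnn2_infinite n"
  shows "X \<in> unitri_nonneg n" "minors2_nonneg X" "\<not> finitely_supported X"
  using assms by (auto simp: tnn2_infinite_def)

text \<open>Makes the denominators in \<open>asw_eps\<close> positive. A nonzero entry at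
  \<open>(p, q)\<close> spreads to all positions between, via minors through the unit diagonal
  entries at \<open>i'\<close> and \<open>j'\<close>. It is taken more than \<open>n\<close> further
  from the diagonal than \<open>(i, j)\<close>, so that a period shift fits between.\<close>

lemma tnn2_infinite_pos:
  assumes "n \<ge> 1" "X \<in> tnn2_infinite n" "i \<le> j"
  shows "0 < X i j"
proof -
  note X = tnn2_infiniteD[OF assms(2)]
  note U = unitri_nonnegD[OF X(1)]
  from X(3) obtain p q where pq: "q - p > (j - i) + int n" "X p q \<noteq> 0"
    unfolding finitely_supported_def by blast
  have pos: "0 < X p q" using pq(2) U(3)[of p q] by linarith
  define k where "k = - ((i - p) div int n)"
  define i' where "i' = i + k * int n"
  define j' where "j' = j + k * int n"
  \<comment> \<open>by periodicity, the position \<open>(i, j)\<close> may be moved to \<open>(i', j')\<close> with \<open>p \<le> i' \<le> j' \<le> q\<close>\<close>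
  have "i' = p + (i - p) mod int n"
    by (simp add: i'_def k_def minus_div_mult_eq_mod[symmetric])
  moreover have "0 \<le> (i - p) mod int n" "(i - p) mod int n < int n" using assms(1) by auto
  moreover have "j' = i' + (j - i)" by (simp add: i'_def j'_def)
  ultimately have le: "p \<le> i'" "i' \<le> j'" "j' \<le> q" using pq(1) assms(3) by auto
  have "X p q * X i' i' \<le> X p i' * X i' q"
    by (rule minors2_nonnegD[OF X(2)]) (use le in auto)
  with pos have "X i' q \<noteq> 0" by (auto simp: U(1))
  hence "0 < X i' q" using U(3)[of i' q] by linarith
  moreover have "X i' q * X j' j' \<le> X i' j' * X j' q"
    by (rule minors2_nonnegD[OF X(2)]) (use le in auto)
  ultimately have "X i' j' \<noteq> 0" by (auto simp: U(1))
  hence "0 < X i' j'" using U(3)[of i' j'] by linarith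
  thus ?thesis unfolding i'_def j'_def
    by (simp add: loop_mats_periodic[OF unitri_nonneg_carrier[OF X(1)]])
qed

text \<open>After clearing the positive denominators this is the minor of rows \<open>i\<close>,
  \<open>i + 1\<close> and columns \<open>j\<close>, \<open>k\<close>.\<close>

lemma asw_ratio_antimono:
  assumes "n \<ge> 1" "X \<in> tnn2_infinite n" "i + 1 \<le> j" "j \<le> k"
  shows "X i k / X (i + 1) k \<le> X i j / X (i + 1) j"
  using minors2_nonnegD[OF tnn2_infiniteD(2)[OF assms(2)], of i "i + 1" j k]
    tnn2_infinite_pos[OF assms(1,2), of "i + 1" j] tnn2_infinite_pos[OF assms(1,2), of "i + 1" k] assms(3,4)
  by (simp add: field_simps)

lemma asw_eps_tendsto:
  assumes "n \<ge> 1" "X \<in> tnn2_infinite n"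
  shows "((\<lambda>j. X i j / X (i + 1) j) \<longlongrightarrow> asw_eps X i) at_top"
proof -
  have "\<exists>L. ((\<lambda>j. X i j / X (i + 1) j) \<longlongrightarrow> L) at_top"
    by (rule antimono_nonneg_tendsto_at_top[of "i + 1"])
      (use asw_ratio_antimono[OF assms] unitri_nonnegD(3)[OF tnn2_infiniteD(1)[OF assms(2)]] in auto)
  then obtain L where L: "((\<lambda>j. X i j / X (i + 1) j) \<longlongrightarrow> L) at_top" ..
  from tendsto_Lim[OF trivial_limit_at_top_linorder L] show ?thesis
    using L tnn2_infiniteD(3)[OF assms(2)] by (simp add: asw_eps_def)
qed

lemma asw_eps_nonneg:
  assumes "n \<ge> 1" "X \<in> tnn2_infinite n"
  shows "0 \<le> asw_eps X i"
  by (rule tendsto_lowerbound[OF asw_eps_tendsto[OF assms]])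
    (simp_all add: unitri_nonnegD(3)[OF tnn2_infiniteD(1)[OF assms(2)]])

text \<open>A decreasing ratio stays above its limit; for \<open>j \<le> i\<close> the left side
  vanishes. This keeps the entries of \<open>asw_remainder\<close> nonnegative.\<close>

lemma asw_eps_mult_le:
  assumes "n \<ge> 1" "X \<in> tnn2_infinite n"
  shows "asw_eps X i * X (i + 1) j \<le> X i j"
proof (cases "i + 1 \<le> j")
  case True
  have "asw_eps X i \<le> X i j / X (i + 1) j"
    by (rule tendsto_upperbound[OF asw_eps_tendsto[OF assms]])
      (auto simp: eventually_at_top_linorder intro!: exI[of _ j] asw_ratio_antimono[OF assms True])
  with tnn2_infinite_pos[OF assms True] show ?thesis by (simp add: field_simps)
next
  case False
  thus ?thesis using unitri_nonnegD[OF tnn2_infiniteD(1)[OF assms(2)]] by simp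
qed

lemma asw_eps_le_superdiag:
  assumes "n \<ge> 1" "X \<in> tnn2_infinite n"
  shows "asw_eps X i \<le> X i (i + 1)"
  using asw_eps_mult_le[OF assms, of i "i + 1"]
    unitri_nonnegD[OF tnn2_infiniteD(1)[OF assms(2)]] by simp

text \<open>Shifting rows and columns by the same multiple of \<open>n\<close> leaves the entries
  fixed, and a shift of the column index does not change the limit.\<close>

lemma asw_eps_cong:
  assumes "n \<ge> 1" "X \<in> tnn2_infinite n" "p mod int n = q mod int n"
  shows "asw_eps X p = asw_eps X q"
proof -
  from assms(3) have "int n dvd p - q" by (simp add: mod_eq_dvd_iff)
  then obtain k where "p - q = int n * k" ..
  hence k: "p = q + k * int n" by (simp add: algebra_simps)
  have "((\<lambda>j. X p (j + k * int n) / X (p + 1) (j + k * int n)) \<longlongrightarrow> asw_eps X p) at_top"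
  proof (rule filterlim_compose[OF asw_eps_tendsto[OF assms(1,2)]])
    have "\<exists>N. \<forall>j\<ge>N. Z \<le> j + k * int n" for Z
      by (rule exI[of _ "Z - k * int n"]) simp
    thus "LIM j at_top. j + k * int n :> at_top"
      by (simp add: filterlim_at_top eventually_at_top_linorder)
  qed
  moreover have "X p (j + k * int n) = X q j" "X (p + 1) (j + k * int n) = X (q + 1) j" for j
    using loop_mats_periodic[OF unitri_nonneg_carrier[OF tnn2_infiniteD(1)[OF assms(2)]], of q k j]
      loop_mats_periodic[OF unitri_nonneg_carrier[OF tnn2_infiniteD(1)[OF assms(2)]], of "q + 1" k j]
    by (simp_all add: k algebra_simps)
  ultimately have "((\<lambda>j. X q j / X (q + 1) j) \<longlongrightarrow> asw_eps X p) at_top" by simp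
  from tendsto_unique[OF trivial_limit_at_top_linorder this asw_eps_tendsto[OF assms(1,2)]]
  show ?thesis .
qed

text \<open>For \<open>n \<ge> 2\<close> neighbouring rows have different residues, so a generator
  that changes row \<open>p\<close> leaves row \<open>p + 1\<close> alone.\<close>

lemma mod_succ_neq:
  fixes p :: int
  assumes "n \<ge> 2" "p mod int n = i mod int n"
  shows "(p + 1) mod int n \<noteq> i mod int n"
proof
  assume "(p + 1) mod int n = i mod int n"
  hence "int n dvd (p + 1) - p" using assms(2) by (metis mod_eq_dvd_iff)
  hence "int n dvd 1" by simp
  thus False using assms(1) by auto
qed

section \<open>Effect of one Chevalley generator on the numbers \<epsilon>\<close>

context
  fixes n :: nat and i :: int and a :: real and X X' :: loop_mat
  assumes n: "n \<ge> 2" and a: "a \<ge> 0"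
    and X: "X \<in> tnn2_infinite n" and X': "X' \<in> tnn2_infinite n"
    and eq: "X = chevalley n i a \<otimes>\<^bsub>loop_mats n\<^esub> X'"
begin

lemma chevalley_left_row:
  "X p q = X' p q + (if p mod int n = i mod int n then a * X' (p + 1) q else 0)"
  unfolding eq by (rule chevalley_mult)
    (rule unitri_nonneg_carrier[OF tnn2_infiniteD(1)[OF X']])

text \<open>Row \<open>p\<close> gains \<open>a\<close> times row \<open>p + 1\<close>, which itself
  is unchanged, so every ratio, and hence the limit, grows by \<open>a\<close>.\<close>

lemma asw_eps_chevalley_same:
  assumes "p mod int n = i mod int n"
  shows "asw_eps X p = asw_eps X' p + a"
proof -
  have n1: "n \<ge> 1" using n by simp
  have "eventually (\<lambda>j. X' p j / X' (p + 1) j + a = X p j / X (p + 1) j) at_top"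
    unfolding eventually_at_top_linorder
  proof (intro exI allI impI)
    fix j assume "j \<ge> p + 1"
    hence "0 < X' (p + 1) j" using tnn2_infinite_pos[OF n1 X'] by simp
    thus "X' p j / X' (p + 1) j + a = X p j / X (p + 1) j"
      using assms mod_succ_neq[OF n assms] by (simp add: chevalley_left_row field_simps)
  qed
  from tendsto_cong[OF this]
  have "((\<lambda>j. X p j / X (p + 1) j) \<longlongrightarrow> asw_eps X' p + a) at_top"
    using tendsto_add[OF asw_eps_tendsto[OF n1 X', of p] tendsto_const[of a]] by simp
  from tendsto_unique[OF trivial_limit_at_top_linorder asw_eps_tendsto[OF n1 X] this]
  show ?thesis .
qed

lemma asw_eps_chevalley_other:
  assumes "p mod int n \<noteq> i mod int n" "(p + 1) mod int n \<noteq> i mod int n"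
  shows "asw_eps X p = asw_eps X' p"
proof -
  have n1: "n \<ge> 1" using n by simp
  have "(\<lambda>j. X p j / X (p + 1) j) = (\<lambda>j. X' p j / X' (p + 1) j)"
    using assms by (simp add: chevalley_left_row)
  with asw_eps_tendsto[OF n1 X, of p]
  have "((\<lambda>j. X' p j / X' (p + 1) j) \<longlongrightarrow> asw_eps X p) at_top" by simp
  from tendsto_unique[OF trivial_limit_at_top_linorder this asw_eps_tendsto[OF n1 X']]
  show ?thesis .
qed

lemma asw_eps_chevalley_pred:
  assumes p: "(p + 1) mod int n = i mod int n" and "a > 0"
  shows "asw_eps X p = asw_eps X' p * asw_eps X' (p + 1) / (asw_eps X' (p + 1) + a)"
proof -
  have n1: "n \<ge> 1" using n by simp
  have p': "p mod int n \<noteq> i mod int n" using mod_succ_neq[OF n] p by metis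
  \<comment> \<open>Only the denominator row \<open>p + 1\<close> changes, by \<open>a\<close> times
    row \<open>p + 2\<close>. Dividing by row \<open>p + 2\<close> expresses the new ratio through
    the old ones of rows \<open>p\<close> and \<open>p + 1\<close>.\<close>
  define r where "r = (\<lambda>j. X' (p + 1) j / X' (p + 1 + 1) j)"
  have "eventually (\<lambda>j. X' p j / X' (p + 1) j * (r j / (r j + a)) = X p j / X (p + 1) j) at_top"
    unfolding eventually_at_top_linorder
  proof (intro exI allI impI)
    fix j assume "j \<ge> p + 1 + 1"
    hence pos: "0 < X' (p + 1) j" "0 < X' (p + 1 + 1) j"
      using tnn2_infinite_pos[OF n1 X'] by simp_all
    hence "r j + a = (X' (p + 1) j + a * X' (p + 1 + 1) j) / X' (p + 1 + 1) j"
      by (simp add: r_def add_divide_distrib)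
    hence "r j / (r j + a) = X' (p + 1) j / (X' (p + 1) j + a * X' (p + 1 + 1) j)"
      using pos by (simp add: r_def)
    moreover have "X (p + 1) j = X' (p + 1) j + a * X' (p + 1 + 1) j" "X p j = X' p j"
      using p p' by (simp_all add: chevalley_left_row)
    ultimately show "X' p j / X' (p + 1) j * (r j / (r j + a)) = X p j / X (p + 1) j"
      using pos by simp
  qed
  note cong = tendsto_cong[OF this]
  have r: "(r \<longlongrightarrow> asw_eps X' (p + 1)) at_top"
    unfolding r_def by (rule asw_eps_tendsto[OF n1 X'])
  \<comment> \<open>Positivity of \<open>a\<close> keeps the limit of the denominator nonzero even
    if \<open>asw_eps X' (p + 1)\<close> is 0.\<close>
  have "((\<lambda>j. X' p j / X' (p + 1) j * (r j / (r j + a))) \<longlongrightarrow>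
    asw_eps X' p * (asw_eps X' (p + 1) / (asw_eps X' (p + 1) + a))) at_top"
    using asw_eps_nonneg[OF n1 X', of "p + 1"] \<open>a > 0\<close>
    by (intro tendsto_mult tendsto_divide tendsto_add tendsto_const r asw_eps_tendsto[OF n1 X'])
      simp
  hence "((\<lambda>j. X p j / X (p + 1) j) \<longlongrightarrow>
    asw_eps X' p * (asw_eps X' (p + 1) / (asw_eps X' (p + 1) + a))) at_top"
    by (simp only: cong)
  from tendsto_unique[OF trivial_limit_at_top_linorder asw_eps_tendsto[OF n1 X] this]
  show ?thesis by simp
qed

end

subsection \<open>ASW factorization and Chevalley generators\<close>

text \<open>Left multiplication by the inverse curl, written as a row operation: that inverse is
  bidiagonal with entries \<open>- asw_eps X p\<close> above the diagonal.
  \<open>inv_curl_asw_eps_mult\<close> makes the identification.\<close>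

definition asw_remainder :: "loop_mat \<Rightarrow> loop_mat" where
  "asw_remainder X = (\<lambda>p q. X p q - asw_eps X p * X (p + 1) q)"

lemma asw_remainder_le:
  assumes "n \<ge> 1" "X \<in> tnn2_infinite n"
  shows "asw_remainder X p q \<le> X p q"
  using asw_eps_nonneg[OF assms] unitri_nonnegD(3)[OF tnn2_infiniteD(1)[OF assms(2)]]
  by (simp add: asw_remainder_def)

lemma asw_remainder_unitri_nonneg:
  assumes "n \<ge> 1" "X \<in> tnn2_infinite n"
  shows "asw_remainder X \<in> unitri_nonneg n"
proof -
  note X = tnn2_infiniteD(1)[OF assms(2)]
  have "asw_eps X (p + int n) = asw_eps X p" for p
    by (rule asw_eps_cong[OF assms]) simp
  moreover have "X (p + int n) (q + int n) = X p q" "X (p + int n + 1) (q + int n) = X (p + 1) q" for p q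
    using loop_mats_periodic[OF unitri_nonneg_carrier[OF X], of p 1 q]
      loop_mats_periodic[OF unitri_nonneg_carrier[OF X], of "p + 1" 1 q]
    by (simp_all add: algebra_simps)
  ultimately show ?thesis
    unfolding unitri_nonneg_def asw_remainder_def
    by (auto simp: unitri_nonnegD[OF X] asw_eps_mult_le[OF assms])
qed

context
  fixes n :: nat and i :: int and a b :: real and X X' :: loop_mat
  assumes n: "n \<ge> 2" and a: "a \<ge> 0"
    and X: "X \<in> tnn2_infinite n" and X': "X' \<in> tnn2_infinite n"
    and eq: "X = chevalley n i a \<otimes>\<^bsub>loop_mats n\<^esub> X'"
  defines "b \<equiv> a * asw_eps X' (i - 1) / (asw_eps X' i + a)"
begin

lemma shifted_param_bounds: "0 \<le> b" "b \<le> asw_eps X' (i - 1)"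
proof -
  have n1: "n \<ge> 1" using n by simp
  note nn = asw_eps_nonneg[OF n1 X']
  show "0 \<le> b" unfolding b_def using nn a by (intro divide_nonneg_nonneg mult_nonneg_nonneg) auto
  show "b \<le> asw_eps X' (i - 1)"
  proof (cases "a = 0")
    case False
    hence "0 < asw_eps X' i + a" using nn[of i] a by linarith
    thus ?thesis unfolding b_def using nn[of i] nn[of "i - 1"]
      by (simp add: pos_divide_le_eq algebra_simps)
  qed (simp add: b_def nn)
qed

text \<open>
  These identities, together with \<open>\<epsilon>\<^sub>i(X) = \<epsilon>\<^sub>i(X') + a\<close>, say exactly that
  \<open>N(\<epsilon>(X))\<^sup>-\<^sup>1 e\<^sub>i(a) = e\<^bsub>i-1\<^esub>(b) N(\<epsilon>(X'))\<^sup>-\<^sup>1\<close>. The junk value \<open>b = 0\<close> for a vanishing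
  denominator, which forces \<open>a = 0\<close>, is the right one.
\<close>

lemma asw_eps_chevalley_pred_shifted:
  assumes p: "(p + 1) mod int n = i mod int n"
  shows "asw_eps X p = asw_eps X' p - b" "a * asw_eps X p = b * asw_eps X' (p + 1)"
proof -
  have n1: "n \<ge> 1" using n by simp
  have e: "asw_eps X' (p + 1) = asw_eps X' i" by (rule asw_eps_cong[OF n1 X' p])
  have "p mod int n = (i - 1) mod int n"
    using p by (metis add_diff_cancel_right' mod_diff_left_eq)
  hence e': "asw_eps X' p = asw_eps X' (i - 1)" by (rule asw_eps_cong[OF n1 X'])
  have "asw_eps X p = asw_eps X' p - b \<and> a * asw_eps X p = b * asw_eps X' (p + 1)"
  proof (cases "a = 0")
    case True
    have "X = X'" using chevalley_left_row[OF n a X X' eq] True by (intro ext) simp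
    thus ?thesis using True by (simp add: b_def)
  next
    case False
    with a have "a > 0" by simp
    hence pos: "0 < asw_eps X' i + a" using asw_eps_nonneg[OF n1 X', of i] by linarith
    have "asw_eps X p = asw_eps X' (i - 1) * asw_eps X' i / (asw_eps X' i + a)"
      using asw_eps_chevalley_pred[OF n a X X' eq p \<open>a > 0\<close>] by (simp add: e e')
    thus ?thesis using pos unfolding b_def e e' by (simp add: field_simps)
  qed
  thus "asw_eps X p = asw_eps X' p - b" "a * asw_eps X p = b * asw_eps X' (p + 1)" by auto
qed

lemma asw_remainder_chevalley_row:
  "asw_remainder X p q =
    asw_remainder X' p q + (if p mod int n = (i - 1) mod int n then b * asw_remainder X' (p + 1) q else 0)"
proof -
  have n1: "n \<ge> 1" using n by simp
  note row = chevalley_left_row[OF n a X X' eq]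
  have iff: "p mod int n = (i - 1) mod int n \<longleftrightarrow> (p + 1) mod int n = i mod int n"
    by (metis add_diff_cancel_right' diff_add_cancel mod_add_left_eq mod_diff_left_eq)
  consider "(p + 1) mod int n = i mod int n" | "p mod int n = i mod int n"
    | "(p + 1) mod int n \<noteq> i mod int n" "p mod int n \<noteq> i mod int n" by blast
  thus ?thesis
  proof cases
    \<comment> \<open>Row \<open>p\<close> itself is unchanged, but \<open>asw_eps X p\<close> and
      row \<open>p + 1\<close> change. The two identities for \<open>b\<close> convert the
      coefficients of rows \<open>p + 1\<close> and \<open>p + 2\<close> into those required on the
      right.\<close>
    case 1
    hence "p mod int n \<noteq> i mod int n" using mod_succ_neq[OF n] by metis
    hence "asw_remainder X p q = X' p q - asw_eps X p * (X' (p + 1) q + a * X' (p + 1 + 1) q)"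
      using 1 by (simp add: asw_remainder_def row)
    also have "\<dots> = X' p q - asw_eps X p * X' (p + 1) q - (a * asw_eps X p) * X' (p + 1 + 1) q"
      by (simp only: distrib_left diff_diff_eq mult_ac)
    also have "\<dots> = X' p q - (asw_eps X' p - b) * X' (p + 1) q
        - (b * asw_eps X' (p + 1)) * X' (p + 1 + 1) q"
      by (simp only: asw_eps_chevalley_pred_shifted(2)[OF 1]) (simp only: asw_eps_chevalley_pred_shifted(1)[OF 1])
    also have "\<dots> = asw_remainder X' p q + b * asw_remainder X' (p + 1) q"
      by (simp add: asw_remainder_def left_diff_distrib right_diff_distrib)
    finally show ?thesis using 1 iff by simp
  next
    \<comment> \<open>The increase of \<open>asw_eps X p\<close> by \<open>a\<close> cancels the
      \<open>a\<close> times row \<open>p + 1\<close> that row \<open>p\<close> gained.\<close>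
    case 2
    thus ?thesis using mod_succ_neq[OF n 2] iff asw_eps_chevalley_same[OF n a X X' eq 2]
      by (simp add: asw_remainder_def row algebra_simps)
  next
    case 3
    thus ?thesis using iff asw_eps_chevalley_other[OF n a X X' eq 3(2,1)]
      by (simp add: asw_remainder_def row)
  qed
qed

lemma asw_remainder_chevalley:
  "asw_remainder X = chevalley n (i - 1) b \<otimes>\<^bsub>loop_mats n\<^esub> asw_remainder X'"
proof (intro ext)
  fix p q
  have n1: "n \<ge> 1" using n by simp
  show "asw_remainder X p q = (chevalley n (i - 1) b \<otimes>\<^bsub>loop_mats n\<^esub> asw_remainder X') p q"
    unfolding chevalley_mult[OF unitri_nonneg_carrier[OF asw_remainder_unitri_nonneg[OF n1 X']]]
    by (rule asw_remainder_chevalley_row)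
qed

text \<open>In a row \<open>p\<close> congruent to \<open>i - 1\<close> the remainder of
  \<open>X'\<close> has lost \<open>asw_eps X' p * X' (p + 1) q\<close>. Since
  \<open>b \<le> asw_eps X' (i - 1)\<close>, the generator gives back at most that.\<close>

lemma asw_remainder_chevalley_le: "asw_remainder X p q \<le> X' p q"
proof -
  have n1: "n \<ge> 1" using n by simp
  note U = unitri_nonnegD(3)[OF asw_remainder_unitri_nonneg[OF n1 X']]
  show ?thesis
  proof (cases "p mod int n = (i - 1) mod int n")
    case True
    have "b * asw_remainder X' (p + 1) q \<le> asw_eps X' (i - 1) * X' (p + 1) q"
      by (rule mult_mono[OF shifted_param_bounds(2) asw_remainder_le[OF n1 X']
            asw_eps_nonneg[OF n1 X'] U])
    moreover have "asw_eps X' (i - 1) = asw_eps X' p"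
      by (rule asw_eps_cong[OF n1 X']) (use True in simp)
    ultimately show ?thesis
      unfolding asw_remainder_chevalley_row using True by (simp add: asw_remainder_def)
  next
    case False
    thus ?thesis unfolding asw_remainder_chevalley_row using asw_remainder_le[OF n1 X'] by simp
  qed
qed

text \<open>Only the numbers at \<open>i - 1\<close> and \<open>i\<close> change, and
  \<open>asw_eps_chevalley_same\<close> with \<open>asw_eps_chevalley_pred_shifted\<close> shows
  that their product does not.\<close>

lemma prod_asw_eps_chevalley:
  "(\<Prod>l<n. asw_eps X (p + int l)) = (\<Prod>l<n. asw_eps X' (p + int l))"
proof -
  have n1: "n \<ge> 1" using n by simp
  \<comment> \<open>Periodicity makes a product over \<open>n\<close> consecutive indices
    independent of its start, so it may start at \<open>i - 1\<close>, with the two changing factors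
    in front.\<close>
  have shift: "(\<Prod>l<n. asw_eps Z (q + int l)) = (\<Prod>l<n. asw_eps Z (q' + int l))"
    if Z: "Z \<in> tnn2_infinite n" for Z q q'
  proof -
    define f where "f = (\<lambda>q. \<Prod>l<n. asw_eps Z (q + int l))"
    have step: "f q = f (q + 1)" for q
    proof -
      obtain n' where n': "n = Suc n'" using n by (cases n) auto
      have "asw_eps Z q = asw_eps Z (q + 1 + int n')"
      proof (rule asw_eps_cong[OF n1 Z])
        have "q + 1 + int n' = q + int n" by (simp add: n')
        thus "q mod int n = (q + 1 + int n') mod int n" by (simp only: mod_add_self2)
      qed
      thus ?thesis unfolding f_def n'
        by (subst prod.lessThan_Suc_shift, subst prod.lessThan_Suc) (simp add: algebra_simps)
    qed
    have "f q = f 0" for q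
      by (induction q rule: int_induct[where k = 0]) (use step[of "q - 1" for q] step in auto)
    hence "f q = f q'" by metis
    thus ?thesis by (simp add: f_def)
  qed
  obtain n' where n': "n = Suc (Suc n')" using n by (metis Suc_le_D numeral_2_eq_2 Suc_le_mono)
  have rest: "asw_eps X (i + (1 + int l)) = asw_eps X' (i + (1 + int l))" if "l < n'" for l
  proof (rule asw_eps_chevalley_other[OF n a X X' eq])
    show "(i + (1 + int l)) mod int n \<noteq> i mod int n"
    proof
      assume "(i + (1 + int l)) mod int n = i mod int n"
      hence "int n dvd 1 + int l" by (simp add: mod_eq_dvd_iff)
      hence "int n \<le> 1 + int l" by (rule zdvd_imp_le) simp
      thus False using that n' by simp
    qed
    show "(i + (1 + int l) + 1) mod int n \<noteq> i mod int n"
    proof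
      assume "(i + (1 + int l) + 1) mod int n = i mod int n"
      hence "int n dvd 2 + int l" by (simp add: mod_eq_dvd_iff)
      hence "int n \<le> 2 + int l" by (rule zdvd_imp_le) simp
      thus False using that n' by simp
    qed
  qed
  have split: "(\<Prod>l<n. asw_eps Z (i - 1 + int l)) =
      asw_eps Z (i - 1) * asw_eps Z i * (\<Prod>l<n'. asw_eps Z (i + (1 + int l)))" for Z
    unfolding n' prod.lessThan_Suc_shift by (simp add: ac_simps)
  have "asw_eps X i = asw_eps X' i + a"
    by (rule asw_eps_chevalley_same[OF n a X X' eq refl])
  moreover have "asw_eps X (i - 1) = asw_eps X' (i - 1) - b"
    "a * asw_eps X (i - 1) = b * asw_eps X' i"
    using asw_eps_chevalley_pred_shifted[of "i - 1"] by simp_all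
  ultimately have "asw_eps X (i - 1) * asw_eps X i = asw_eps X' (i - 1) * asw_eps X' i"
    by algebra
  hence "(\<Prod>l<n. asw_eps X (i - 1 + int l)) = (\<Prod>l<n. asw_eps X' (i - 1 + int l))"
    unfolding split using rest by simp
  thus ?thesis using shift[OF X, of p "i - 1"] shift[OF X', of p "i - 1"] by simp
qed

end

subsection \<open>Infinite products of Chevalley generators\<close>

text \<open>
  \<open>Xs m\<close> is the tail of the infinite product after its first \<open>m\<close> factors; factors are indexed
  from 0 here. Zero parameters must be allowed, since ASW factorization creates them.
\<close>

definition factor_chain :: "nat \<Rightarrow> (nat \<Rightarrow> int) \<Rightarrow> (nat \<Rightarrow> real) \<Rightarrow> (nat \<Rightarrow> loop_mat) \<Rightarrow> bool" where
  "factor_chain n w a Xs \<longleftrightarrow>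
     (\<forall>m. Xs m \<in> unitri_nonneg n \<and> 0 \<le> a m \<and>
        Xs m = chevalley n (w m) (a m) \<otimes>\<^bsub>loop_mats n\<^esub> Xs (Suc m)) \<and>
     entrywise_lim Xs \<one>\<^bsub>loop_mats n\<^esub>"

lemma factor_chainD:
  assumes "factor_chain n w a Xs"
  shows "Xs m \<in> unitri_nonneg n" "0 \<le> a m"
    "Xs m = chevalley n (w m) (a m) \<otimes>\<^bsub>loop_mats n\<^esub> Xs (Suc m)"
    "entrywise_lim Xs \<one>\<^bsub>loop_mats n\<^esub>"
  using assms unfolding factor_chain_def by blast+

lemma factor_chain_prefix:
  assumes "factor_chain n w a Xs"
  shows "Xs 0 = list_prod n (map (\<lambda>l. chevalley n (w l) (a l)) [0..<m]) \<otimes>\<^bsub>loop_mats n\<^esub> Xs m"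
proof (induction m)
  case 0
  have "Xs 0 \<in> carrier (loop_mats n)"
    by (rule unitri_nonneg_carrier[OF factor_chainD(1)[OF assms]])
  thus ?case by (simp add: list_prod_Nil monoid.l_one[OF monoid_loop_mats])
next
  case (Suc m)
  have c: "chevalley n (w l) (a l) \<in> carrier (loop_mats n)" for l
    by (rule unitri_nonneg_carrier[OF chevalley_unitri_nonneg[OF factor_chainD(2)[OF assms]]])
  have x: "Xs l \<in> carrier (loop_mats n)" for l
    by (rule unitri_nonneg_carrier[OF factor_chainD(1)[OF assms]])
  define P where "P = list_prod n (map (\<lambda>l. chevalley n (w l) (a l)) [0..<m])"
  have P: "P \<in> carrier (loop_mats n)" unfolding P_def
    by (rule list_prod_closed) (auto intro: c)
  have "list_prod n (map (\<lambda>l. chevalley n (w l) (a l)) [0..<Suc m])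
    = P \<otimes>\<^bsub>loop_mats n\<^esub> chevalley n (w m) (a m)"
    unfolding P_def using c
    by (simp add: list_prod_append list_prod_Cons list_prod_Nil image_subset_iff
        monoid.r_one[OF monoid_loop_mats])
  moreover have "Xs 0 = P \<otimes>\<^bsub>loop_mats n\<^esub> (chevalley n (w m) (a m) \<otimes>\<^bsub>loop_mats n\<^esub> Xs (Suc m))"
    using Suc factor_chainD(3)[OF assms, of m] by (simp only: P_def)
  ultimately show ?case by (simp only: loop_mats_mult_assoc[OF P c x])
qed

lemma factor_chain_shift:
  assumes "factor_chain n w a Xs"
  shows "factor_chain n (\<lambda>l. w (l + m)) (\<lambda>l. a (l + m)) (\<lambda>l. Xs (l + m))"
proof -
  have "(\<lambda>l. Xs (l + m) i j) \<longlonglongrightarrow> \<one>\<^bsub>loop_mats n\<^esub> i j" for i j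
    using factor_chainD(4)[OF assms] by (auto simp: entrywise_lim_def intro!: LIMSEQ_ignore_initial_segment)
  thus ?thesis using factor_chainD(1-3)[OF assms]
    unfolding factor_chain_def entrywise_lim_def add_Suc by blast
qed

text \<open>\<open>Xs 0\<close> is a limit of finite products of generators; every other tail is the
  head of a shifted chain.\<close>

lemma factor_chain_minors2:
  assumes "factor_chain n w a Xs"
  shows "minors2_nonneg (Xs m)"
proof -
  have head: "minors2_nonneg (Xs 0)" if ch: "factor_chain n w a Xs" for w a Xs
  proof (rule minors2_nonneg_lim)
    note a = factor_chainD(2)[OF ch]
    show "entrywise_lim (\<lambda>m. list_prod n (map (\<lambda>l. chevalley n (w l) (a l)) [0..<m])) (Xs 0)"
    proof (rule entrywise_lim_left_factor)
      show "list_prod n (map (\<lambda>l. chevalley n (w l) (a l)) [0..<m]) \<in> unitri_nonneg n" for m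
        by (rule list_prod_unitri_nonneg) (use a in \<open>auto intro: chevalley_unitri_nonneg\<close>)
    qed (fact factor_chainD(1)[OF ch] factor_chain_prefix[OF ch] factor_chainD(4)[OF ch])+
    show "minors2_nonneg (list_prod n (map (\<lambda>l. chevalley n (w l) (a l)) [0..<m]))" for m
      by (rule minors2_nonneg_chevalley_prod[OF a])
  qed
  from head[OF factor_chain_shift[OF assms, of m]] show ?thesis by simp
qed

text \<open>A generator widens the support by at most one diagonal, so a finitely supported tail
  would make all earlier tails finitely supported.\<close>

lemma factor_chain_tnn2_infinite:
  assumes ch: "factor_chain n w a Xs" and inf: "\<not> finitely_supported (Xs 0)"
  shows "Xs m \<in> tnn2_infinite n"
proof -
  note U = factor_chainD(1)[OF ch]
  have "\<not> finitely_supported (Xs m)"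
  proof (induction m)
    case (Suc m)
    show ?case
    proof
      assume "finitely_supported (Xs (Suc m))"
      then obtain d where d: "\<And>i j. j - i > d \<Longrightarrow> Xs (Suc m) i j = 0"
        unfolding finitely_supported_def by blast
      have "Xs m i j = 0" if "j - i > d + 1" for i j
        unfolding factor_chainD(3)[OF ch, of m] using that
        by (simp add: chevalley_mult[OF unitri_nonneg_carrier[OF U]] d)
      with Suc show False unfolding finitely_supported_def by blast
    qed
  qed (fact inf)
  with U factor_chain_minors2[OF ch] show ?thesis by (simp add: tnn2_infinite_def)
qed

text \<open>
  The product \<open>\<epsilon>\<^sub>1 \<cdots> \<epsilon>\<^sub>n\<close> is the same for all tails, while each \<open>\<epsilon>\<^sub>p\<close> of the tails tends to 0.
\<close>

lemma factor_chain_eps_zero: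
  assumes n: "n \<ge> 2" and ch: "factor_chain n w a Xs" and inf: "\<not> finitely_supported (Xs 0)"
  shows "\<exists>p. asw_eps (Xs 0) p = 0"
proof -
  have n1: "n \<ge> 1" using n by simp
  note X = factor_chain_tnn2_infinite[OF ch inf]
  have const: "(\<Prod>l<n. asw_eps (Xs m) (0 + int l)) = (\<Prod>l<n. asw_eps (Xs 0) (0 + int l))" for m
  proof (induction m)
    case (Suc m)
    have "(\<Prod>l<n. asw_eps (Xs m) (0 + int l)) = (\<Prod>l<n. asw_eps (Xs (Suc m)) (0 + int l))"
      by (rule prod_asw_eps_chevalley[OF n factor_chainD(2)[OF ch] X X factor_chainD(3)[OF ch]])
    with Suc show ?case by simp
  qed simp
  have lim: "(\<lambda>m. asw_eps (Xs m) p) \<longlonglongrightarrow> 0" for p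
  proof (rule tendsto_sandwich[OF _ _ tendsto_const])
    show "(\<lambda>m. Xs m p (p + 1)) \<longlonglongrightarrow> 0"
      using factor_chainD(4)[OF ch, unfolded entrywise_lim_def, rule_format, of p "p + 1"]
      by (simp add: loop_mats_one)
  qed (auto simp: asw_eps_nonneg[OF n1 X] asw_eps_le_superdiag[OF n1 X])
  have "(\<lambda>m. \<Prod>l<n. asw_eps (Xs m) (0 + int l)) \<longlonglongrightarrow> (\<Prod>l<n. 0)"
    by (intro tendsto_prod lim)
  hence "(\<Prod>l<n. asw_eps (Xs 0) (0 + int l)) = (\<Prod>l<n. 0)"
    using LIMSEQ_unique tendsto_const by (subst (asm) ext[OF const]) blast
  also have "\<dots> = 0" using n by simp
  finally show ?thesis using n by (auto simp: prod_zero_iff)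
qed

text \<open>A row with \<open>asw_eps X p = 0\<close> is left unchanged, and all its entries right
  of the diagonal are positive.\<close>

lemma asw_remainder_infinite:
  assumes n: "n \<ge> 1" and X: "X \<in> tnn2_infinite n" and "asw_eps X p = 0"
  shows "\<not> finitely_supported (asw_remainder X)"
proof
  assume "finitely_supported (asw_remainder X)"
  then obtain d where d: "\<And>i j. j - i > d \<Longrightarrow> asw_remainder X i j = 0"
    unfolding finitely_supported_def by blast
  define q where "q = p + \<bar>d\<bar> + 1"
  have "asw_remainder X p q = 0" by (rule d) (simp add: q_def)
  hence "X p q = 0" using assms(3) by (simp add: asw_remainder_def)
  moreover have "0 < X p q" by (rule tnn2_infinite_pos[OF n X]) (simp add: q_def)
  ultimately show False by simp
qed

text \<open>All tails are treated at once, so the remainders satisfy the hypotheses again and the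
  step can be iterated. The last claim trades one application of \<open>asw_remainder\<close> for
  one dropped factor.\<close>

lemma factor_chain_asw_remainder:
  assumes n: "n \<ge> 2" and ch: "factor_chain n w a Xs" and inf: "\<not> finitely_supported (Xs 0)"
  shows "\<exists>w' a'. factor_chain n w' a' (\<lambda>m. asw_remainder (Xs m))"
    and "\<not> finitely_supported (asw_remainder (Xs 0))"
    and "asw_remainder (Xs m) p q \<le> Xs (Suc m) p q"
proof -
  have n1: "n \<ge> 1" using n by simp
  note X = factor_chain_tnn2_infinite[OF ch inf]
  note a = factor_chainD(2)[OF ch] and eq = factor_chainD(3)[OF ch]
  show "\<not> finitely_supported (asw_remainder (Xs 0))"
    using factor_chain_eps_zero[OF n ch inf] asw_remainder_infinite[OF n1 X] by blast
  show "asw_remainder (Xs m) p q \<le> Xs (Suc m) p q"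
    by (rule asw_remainder_chevalley_le[OF n a X X eq])
  define b where "b = (\<lambda>m. a m * asw_eps (Xs (Suc m)) (w m - 1) / (asw_eps (Xs (Suc m)) (w m) + a m))"
  have "entrywise_lim (\<lambda>m. asw_remainder (Xs m)) \<one>\<^bsub>loop_mats n\<^esub>"
    unfolding entrywise_lim_def
  proof (intro allI)
    fix i j
    show "(\<lambda>m. asw_remainder (Xs m) i j) \<longlonglongrightarrow> \<one>\<^bsub>loop_mats n\<^esub> i j"
    proof (cases "i = j")
      case True
      thus ?thesis
        by (simp add: unitri_nonnegD[OF asw_remainder_unitri_nonneg[OF n1 X]] loop_mats_one)
    next
      case False
      have "(\<lambda>m. Xs m i j) \<longlonglongrightarrow> 0"
        using factor_chainD(4)[OF ch, unfolded entrywise_lim_def, rule_format, of i j] False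
        by (simp add: loop_mats_one)
      from tendsto_sandwich[OF _ _ tendsto_const this]
      have "(\<lambda>m. asw_remainder (Xs m) i j) \<longlonglongrightarrow> 0"
        using unitri_nonnegD(3)[OF asw_remainder_unitri_nonneg[OF n1 X]] asw_remainder_le[OF n1 X]
        by (simp add: always_eventually)
      with False show ?thesis by (simp add: loop_mats_one)
    qed
  qed
  moreover have "asw_remainder (Xs m) = chevalley n (w m - 1) (b m) \<otimes>\<^bsub>loop_mats n\<^esub> asw_remainder (Xs (Suc m))" for m
    unfolding b_def by (rule asw_remainder_chevalley[OF n a X X eq])
  moreover have "0 \<le> b m" for m
    unfolding b_def by (rule shifted_param_bounds(1)[OF n a X X eq])
  ultimately have "factor_chain n (\<lambda>m. w m - 1) b (\<lambda>m. asw_remainder (Xs m))"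
    unfolding factor_chain_def using asw_remainder_unitri_nonneg[OF n1 X] by blast
  thus "\<exists>w' a'. factor_chain n w' a' (\<lambda>m. asw_remainder (Xs m))" by blast
qed

lemma funpow_asw_remainder_le:
  assumes n: "n \<ge> 2" and "factor_chain n w a Xs" "\<not> finitely_supported (Xs 0)"
  shows "(asw_remainder ^^ k) (Xs m) \<in> tnn2_infinite n"
    and "(asw_remainder ^^ k) (Xs m) p q \<le> Xs (m + k) p q"
proof -
  have n1: "n \<ge> 1" using n by simp
  have step: "(\<exists>w a. factor_chain n w a (\<lambda>m. (asw_remainder ^^ k) (Xs m))) \<and>
     \<not> finitely_supported ((asw_remainder ^^ k) (Xs 0)) \<and>
     (\<forall>m p q. (asw_remainder ^^ k) (Xs m) p q \<le> Xs (m + k) p q)" for k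
  proof (induction k)
    case 0
    show ?case using assms by auto
  next
    case (Suc k)
    then obtain w a where ch: "factor_chain n w a (\<lambda>m. (asw_remainder ^^ k) (Xs m))"
      and inf: "\<not> finitely_supported ((asw_remainder ^^ k) (Xs 0))"
      and le: "\<And>m p q. (asw_remainder ^^ k) (Xs m) p q \<le> Xs (m + k) p q" by blast
    note st = factor_chain_asw_remainder[OF n ch inf]
    \<comment> \<open>The outermost remainder brings the iterate of \<open>Xs m\<close> below the
      iterate of \<open>Xs (Suc m)\<close>, to which the induction hypothesis applies.\<close>
    show ?case using st(1,2) order_trans[OF st(3) le] by simp
  qed
  then obtain w a where "factor_chain n w a (\<lambda>m. (asw_remainder ^^ k) (Xs m))" by blast
  from factor_chain_tnn2_infinite[OF this] step
  show "(asw_remainder ^^ k) (Xs m) \<in> tnn2_infinite n" by blast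
  from step show "(asw_remainder ^^ k) (Xs m) p q \<le> Xs (m + k) p q" by blast
qed

subsection \<open>Curls\<close>

text \<open>The inverse of the bidiagonal matrix with 1 on the diagonal and \<open>- e i\<close> at
  \<open>(i, i + 1)\<close>; the two recursions below express this for either side.\<close>

definition upper_prod :: "(int \<Rightarrow> real) \<Rightarrow> loop_mat" where
  "upper_prod e = (\<lambda>i j. if i \<le> j then \<Prod>l\<in>{i..<j}. e l else 0)"

lemma upper_prod_left: "upper_prod e i j = (if i = j then 1 else 0) + e i * upper_prod e (i + 1) j"
proof (cases "i < j")
  case True
  hence "{i..<j} = insert i {i + 1..<j}" by auto
  thus ?thesis using True by (simp add: upper_prod_def)
qed (auto simp: upper_prod_def)

lemma upper_prod_right: "upper_prod e i j = (if i = j then 1 else 0) + upper_prod e i (j - 1) * e (j - 1)"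
proof (cases "i < j")
  case True
  hence "{i..<j} = insert (j - 1) {i..<j - 1}" by auto
  thus ?thesis using True by (simp add: upper_prod_def)
qed (auto simp: upper_prod_def)

context
  fixes n :: nat and a :: "int \<Rightarrow> real"
begin

text \<open>For \<open>n \<ge> 1\<close> the \<open>n\<close>-periodic extension of the values of
  \<open>a\<close> on \<open>{1..n}\<close>, which are all that a whirl sees.\<close>

definition cyc :: "int \<Rightarrow> real" where
  "cyc i = a ((i - 1) mod int n + 1)"

lemma sign_conj_whirl: "sign_conj (whirl n a) i j = (if j = i then 1 else if j = i + 1 then - cyc i else 0)"
  by (auto simp: sign_conj_def whirl_def cyc_def)

lemma sign_conj_whirl_carrier: "sign_conj (whirl n a) \<in> carrier (loop_mats n)"
proof -
  have "(i + int n - 1) mod int n = (i - 1) mod int n" for i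
    by (metis add_diff_eq diff_add_eq mod_add_self2)
  thus ?thesis unfolding loop_mats_carrier_iff sign_conj_whirl
    by (auto simp: cyc_def intro!: exI[of _ 0])
qed

lemma sign_conj_whirl_mult:
  assumes "X \<in> carrier (loop_mats n)"
  shows "(sign_conj (whirl n a) \<otimes>\<^bsub>loop_mats n\<^esub> X) i j = X i j - cyc i * X (i + 1) j"
proof -
  obtain d where d: "\<forall>i j. j - i < d \<longrightarrow> X i j = 0"
    using assms by (auto simp: loop_mats_carrier_iff)
  have "(sign_conj (whirl n a) \<otimes>\<^bsub>loop_mats n\<^esub> X) i j =
     (\<Sum>k\<in>{i, i + 1} \<union> {i + 0..j - d}. sign_conj (whirl n a) i k * X k j)"
    by (rule loop_mats_mult_eq_sum[where d = 0, OF _ d]) (auto simp: sign_conj_whirl)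
  also have "\<dots> = (\<Sum>k\<in>{i, i + 1}. sign_conj (whirl n a) i k * X k j)"
    by (rule sum.mono_neutral_right) (auto simp: sign_conj_whirl)
  finally show ?thesis by (simp add: sign_conj_whirl)
qed

lemma mult_sign_conj_whirl:
  assumes "X \<in> carrier (loop_mats n)"
  shows "(X \<otimes>\<^bsub>loop_mats n\<^esub> sign_conj (whirl n a)) i j = X i j - X i (j - 1) * cyc (j - 1)"
proof -
  obtain d where d: "\<forall>i j. j - i < d \<longrightarrow> X i j = 0"
    using assms by (auto simp: loop_mats_carrier_iff)
  have "(X \<otimes>\<^bsub>loop_mats n\<^esub> sign_conj (whirl n a)) i j =
     (\<Sum>k\<in>{j - 1, j} \<union> {i + d..j - 0}. X i k * sign_conj (whirl n a) k j)"
    by (rule loop_mats_mult_eq_sum[where e = 0, OF d]) (auto simp: sign_conj_whirl)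
  also have "\<dots> = (\<Sum>k\<in>{j - 1, j}. X i k * sign_conj (whirl n a) k j)"
    by (rule sum.mono_neutral_right) (auto simp: sign_conj_whirl)
  finally show ?thesis by (simp add: sign_conj_whirl)
qed

lemma upper_prod_cyc_carrier: "upper_prod cyc \<in> carrier (loop_mats n)"
proof -
  have "upper_prod cyc (i + int n) (j + int n) = upper_prod cyc i j" for i j
  proof -
    have "(i + int n - 1) mod int n = (i - 1) mod int n" for i
      by (metis add_diff_eq diff_add_eq mod_add_self2)
    hence "cyc (l + int n) = cyc l" for l by (simp add: cyc_def)
    hence "(\<Prod>l\<in>{i..<j}. cyc l) = (\<Prod>l\<in>{i + int n..<j + int n}. cyc l)"
      by (intro prod.reindex_bij_witness[where i = "\<lambda>l. l - int n" and j = "\<lambda>l. l + int n"]) auto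
    thus ?thesis by (simp add: upper_prod_def)
  qed
  moreover have "\<forall>i j. j - i < 0 \<longrightarrow> upper_prod cyc i j = 0" by (simp add: upper_prod_def)
  ultimately show ?thesis unfolding loop_mats_carrier_iff by blast
qed

lemma sign_conj_whirl_inverses:
  "sign_conj (whirl n a) \<otimes>\<^bsub>loop_mats n\<^esub> upper_prod cyc = \<one>\<^bsub>loop_mats n\<^esub>"
  "upper_prod cyc \<otimes>\<^bsub>loop_mats n\<^esub> sign_conj (whirl n a) = \<one>\<^bsub>loop_mats n\<^esub>"
proof -
  show "sign_conj (whirl n a) \<otimes>\<^bsub>loop_mats n\<^esub> upper_prod cyc = \<one>\<^bsub>loop_mats n\<^esub>"
  proof (intro ext)
    fix i j
    show "(sign_conj (whirl n a) \<otimes>\<^bsub>loop_mats n\<^esub> upper_prod cyc) i j = \<one>\<^bsub>loop_mats n\<^esub> i j"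
      using upper_prod_left[of cyc i j]
      by (simp add: sign_conj_whirl_mult[OF upper_prod_cyc_carrier] loop_mats_one)
  qed
  show "upper_prod cyc \<otimes>\<^bsub>loop_mats n\<^esub> sign_conj (whirl n a) = \<one>\<^bsub>loop_mats n\<^esub>"
  proof (intro ext)
    fix i j
    show "(upper_prod cyc \<otimes>\<^bsub>loop_mats n\<^esub> sign_conj (whirl n a)) i j = \<one>\<^bsub>loop_mats n\<^esub> i j"
      using upper_prod_right[of cyc i j]
      by (simp add: mult_sign_conj_whirl[OF upper_prod_cyc_carrier] loop_mats_one)
  qed
qed

lemma curl_eq_upper_prod: "curl n a = upper_prod cyc"
  unfolding curl_def
  by (rule monoid.inv_unique'[OF monoid_loop_mats sign_conj_whirl_carrier upper_prod_cyc_carrier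
        sign_conj_whirl_inverses, symmetric])

lemma inv_curl: "inv\<^bsub>loop_mats n\<^esub> (curl n a) = sign_conj (whirl n a)"
  unfolding curl_eq_upper_prod
  by (rule monoid.inv_unique'[OF monoid_loop_mats upper_prod_cyc_carrier sign_conj_whirl_carrier
        sign_conj_whirl_inverses(2,1), symmetric])

lemma curl_unitri_nonneg:
  assumes "\<And>i. a i \<ge> 0"
  shows "curl n a \<in> unitri_nonneg n"
  using upper_prod_cyc_carrier assms
  unfolding curl_eq_upper_prod unitri_nonneg_def loop_mats_carrier_iff
  by (auto simp: upper_prod_def cyc_def intro!: prod_nonneg)

lemma curl_mult_inv_curl_mult:
  assumes "X \<in> carrier (loop_mats n)"
  shows "curl n a \<otimes>\<^bsub>loop_mats n\<^esub> (inv\<^bsub>loop_mats n\<^esub> (curl n a) \<otimes>\<^bsub>loop_mats n\<^esub> X) = X"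
  unfolding inv_curl unfolding curl_eq_upper_prod
  by (simp add: loop_mats_mult_assoc[OF upper_prod_cyc_carrier sign_conj_whirl_carrier assms, symmetric]
      sign_conj_whirl_inverses monoid.l_one[OF monoid_loop_mats assms])

end

lemma inv_curl_asw_eps_mult:
  assumes "n \<ge> 1" "X \<in> tnn2_infinite n"
  shows "inv\<^bsub>loop_mats n\<^esub> (curl n (asw_eps X)) \<otimes>\<^bsub>loop_mats n\<^esub> X = asw_remainder X"
proof (intro ext)
  fix p q
  have "asw_eps X ((p - 1) mod int n + 1) = asw_eps X p"
    by (rule asw_eps_cong[OF assms]) (simp add: mod_add_left_eq)
  thus "(inv\<^bsub>loop_mats n\<^esub> (curl n (asw_eps X)) \<otimes>\<^bsub>loop_mats n\<^esub> X) p q = asw_remainder X p q"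
    unfolding inv_curl
      sign_conj_whirl_mult[OF unitri_nonneg_carrier[OF tnn2_infiniteD(1)[OF assms(2)]]]
    by (simp add: asw_remainder_def cyc_def)
qed

subsection \<open>Infinite reduced words\<close>

lemma word_perm_append: "word_perm n (us @ vs) = word_perm n us \<circ> word_perm n vs"
  by (induction us) (simp_all add: word_perm_def comp_assoc)

text \<open>Only letters congruent to \<open>r\<close> swap elements across the ends of the block
  \<open>{r + 1..r + int n}\<close>, so a word avoiding them preserves the block.\<close>

lemma word_perm_block:
  assumes ws: "\<And>i. i \<in> set ws \<Longrightarrow> i mod int n \<noteq> r mod int n"
  shows "word_perm n ws (j + int n) = word_perm n ws j + int n"
    and "j \<in> {r + 1..r + int n} \<Longrightarrow> word_perm n ws j \<in> {r + 1..r + int n}"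
proof -
  have per: "simple_refl n i (j + int n) = simple_refl n i j + int n" for i j
    by (simp add: simple_refl_def)
  show "word_perm n ws (j + int n) = word_perm n ws j + int n"
    by (induction ws) (simp_all add: word_perm_def per)
  have blk: "simple_refl n i j \<in> {r + 1..r + int n}"
    if i: "i mod int n \<noteq> r mod int n" and j: "j \<in> {r + 1..r + int n}" for i j
  proof -
    have "j \<noteq> r + int n" if "j mod int n = i mod int n" using that i by auto
    moreover have "j \<noteq> r + 1" if "j mod int n = (i + 1) mod int n"
    proof
      assume "j = r + 1"
      with that have "(r + 1) mod int n = (i + 1) mod int n" by simp
      hence "r mod int n = i mod int n" by (metis add_diff_cancel_right' mod_diff_left_eq)
      with i show False by simp
    qed
    ultimately show ?thesis using j by (auto simp: simple_refl_def)
  qed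
  show "word_perm n ws j \<in> {r + 1..r + int n}" if "j \<in> {r + 1..r + int n}"
    using ws by (induction ws) (use that blk in \<open>auto simp: word_perm_def\<close>)
qed

text \<open>A map commuting with the shift by \<open>n\<close> is determined by its values on one
  full period, and the finite block has only finitely many self-maps.\<close>

lemma finite_block_perms:
  assumes n: "n \<ge> 1"
  shows "finite {f :: int \<Rightarrow> int. (\<forall>j. f (j + int n) = f j + int n) \<and> f ` {r + 1..r + int n} \<subseteq> {r + 1..r + int n}}"
    (is "finite ?F")
proof (rule inj_on_finite)
  let ?B = "{r + 1..r + int n}"
  show "finite (PiE ?B (\<lambda>_. ?B))" by (intro finite_PiE) auto
  show "(\<lambda>f. restrict f ?B) ` ?F \<subseteq> PiE ?B (\<lambda>_. ?B)" by auto
  show "inj_on (\<lambda>f. restrict f ?B) ?F"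
  proof (rule inj_onI, rule ext)
    fix f g j assume f: "f \<in> ?F" and g: "g \<in> ?F" and eq: "restrict f ?B = restrict g ?B"
    have per: "h (j + k * int n) = h j + k * int n" if "h \<in> ?F" for h j k
    proof (induction k rule: int_induct[where k = 0])
      case (step1 k)
      have "h (j + k * int n + int n) = h (j + k * int n) + int n" using that by simp
      with step1 show ?case by (simp add: algebra_simps)
    next
      case (step2 k)
      have "h (j + (k - 1) * int n + int n) = h (j + (k - 1) * int n) + int n" using that by simp
      with step2 show ?case by (simp add: algebra_simps)
    qed simp
    define j0 where "j0 = r + 1 + (j - r - 1) mod int n"
    define k where "k = (j - r - 1) div int n"
    have "0 \<le> (j - r - 1) mod int n" "(j - r - 1) mod int n < int n"
      using n by auto
    hence "j0 \<in> ?B" unfolding j0_def by simp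
    hence "f j0 = g j0" using eq by (metis restrict_apply')
    moreover have "j = j0 + k * int n"
      using div_mult_mod_eq[of "j - r - 1" "int n"] by (simp add: j0_def k_def)
    ultimately show "f j = g j" using per[OF f] per[OF g] by simp
  qed
qed

text \<open>
  Words avoiding the letter \<open>r\<close> yield only finitely many permutations, so two different prefixes
  would agree.
\<close>

lemma reduced_word_letter_recurs:
  assumes n: "n \<ge> 1" and red: "infinite_reduced_word n w"
  shows "\<exists>l>m. w l mod int n = r mod int n"
proof (rule ccontr)
  assume "\<not> ?thesis"
  hence no: "w l mod int n \<noteq> r mod int n" if "l > m" for l using that by blast
  define G where "G = (\<lambda>k. word_perm n (map w [Suc m..<Suc k]))"
  define F where "F = {f :: int \<Rightarrow> int. (\<forall>j. f (j + int n) = f j + int n) \<and>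
    f ` {r + 1..r + int n} \<subseteq> {r + 1..r + int n}}"
  have "G k \<in> F" for k
  proof -
    have "i mod int n \<noteq> r mod int n" if "i \<in> set (map w [Suc m..<Suc k])" for i
      using that no by auto
    from word_perm_block[OF this] show ?thesis unfolding G_def F_def by blast
  qed
  hence "finite (G ` {m..})"
    using finite_block_perms[OF n, of r, folded F_def] by (meson finite_subset image_subsetI)
  hence "\<not> inj_on G {m..}" using finite_imageD infinite_Ici by blast
  then obtain k1 k2 where k: "m \<le> k1" "m \<le> k2" "G k1 = G k2" "k1 \<noteq> k2"
    unfolding inj_on_def by auto
  have split: "word_perm n (map w [1..<Suc k]) = word_perm n (map w [1..<Suc m]) \<circ> G k" if "m \<le> k" for k
  proof -
    have "[1..<Suc k] = [1..<Suc m] @ [Suc m..<Suc k]"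
      using that upt_add_eq_append[of 1 "Suc m" "k - m"] by simp
    thus ?thesis unfolding G_def by (simp only: map_append word_perm_append)
  qed
  have "affine_length n (word_perm n (map w [1..<Suc k])) = k" for k
    using red by (simp only: infinite_reduced_word_def)
  with split[OF k(1)] split[OF k(2)] k(3,4) show False by metis
qed

subsection \<open>Convergence of repeated ASW factorization\<close>

text \<open>The tail after \<open>m\<close> factors is the limit in \<open>k\<close> of
  \<open>T m k\<close>, the product of the factors \<open>m + 1\<close> to \<open>k\<close>. These
  products increase in \<open>k\<close> and stay below \<open>X\<close>, since dropping factors at
  either end only lowers entries.\<close>

lemma infinite_product_factor_chain:
  assumes a: "\<And>k. k \<ge> 1 \<Longrightarrow> 0 \<le> a k"
    and lim: "entrywise_lim (\<lambda>k. list_prod n (map (\<lambda>m. chevalley n (w m) (a m)) [1..<Suc k])) X"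
  shows "\<exists>Xs. Xs 0 = X \<and> factor_chain n (\<lambda>m. w (Suc m)) (\<lambda>m. a (Suc m)) Xs"
proof -
  define c where "c = (\<lambda>m. chevalley n (w m) (a m))"
  define T where "T = (\<lambda>m k. list_prod n (map c [Suc m..<Suc k]))"
  have cU: "c m \<in> unitri_nonneg n" if "m \<ge> 1" for m
    unfolding c_def by (rule chevalley_unitri_nonneg[OF a[OF that]])
  have TU: "T m k \<in> unitri_nonneg n" for m k
    unfolding T_def by (rule list_prod_unitri_nonneg) (use cU in auto)
  have T0: "(\<lambda>k. T 0 k i j) \<longlonglongrightarrow> X i j" for i j
    using lim by (simp add: entrywise_lim_def T_def c_def)
  have T_left: "T m k = c (Suc m) \<otimes>\<^bsub>loop_mats n\<^esub> T (Suc m) k" if "m < k" for m k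
    using that unfolding T_def by (subst upt_conv_Cons) (simp_all add: list_prod_Cons)
  have T_right: "T m (Suc k) = T m k \<otimes>\<^bsub>loop_mats n\<^esub> c (Suc k)" if "m \<le> k" for m k
  proof -
    have "[Suc m..<Suc (Suc k)] = [Suc m..<Suc k] @ [Suc k]" using that by simp
    moreover have "list_prod n [c (Suc k)] = c (Suc k)"
      using unitri_nonneg_carrier[OF cU[of "Suc k"]]
      by (simp add: list_prod_Cons list_prod_Nil monoid.r_one[OF monoid_loop_mats])
    moreover have "set (map c [Suc m..<Suc k]) \<subseteq> carrier (loop_mats n)" "set [c (Suc k)] \<subseteq> carrier (loop_mats n)"
      using unitri_nonneg_carrier[OF cU] by auto
    ultimately show ?thesis unfolding T_def by (simp only: map_append list.map list_prod_append)
  qed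
  have T_mono: "T m k i j \<le> T m (Suc k) i j" if "m \<le> k" for m k i j
    unfolding T_right[OF that] by (rule unitri_mult_ge_left[OF TU cU]) simp
  have T_anti: "T (Suc m) k i j \<le> T m k i j" if "m < k" for m k i j
    unfolding T_left[OF that] by (rule unitri_mult_ge_right[OF cU TU]) simp
  have T_le: "T m k i j \<le> X i j" if "m \<le> k" for m k i j
    using that
  proof (induction m)
    case 0
    have "incseq (\<lambda>k. T 0 k i j)" by (rule incseq_SucI) (simp add: T_mono)
    from incseq_le[OF this T0] show ?case .
  next
    case (Suc m)
    with T_anti[of m k i j] show ?case by simp
  qed
  have "\<exists>L. (\<lambda>k. T m k i j) \<longlonglongrightarrow> L" for m i j
  proof -
    have "incseq (\<lambda>k. T m (k + m) i j)" by (rule incseq_SucI) (simp add: T_mono)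
    moreover have "\<forall>k. T m (k + m) i j \<le> X i j" by (simp add: T_le)
    ultimately obtain L where "(\<lambda>k. T m (k + m) i j) \<longlonglongrightarrow> L"
      by (rule incseq_convergent)
    thus ?thesis by (auto dest: LIMSEQ_offset)
  qed
  then obtain Xs where Xs: "(\<lambda>k. T m k i j) \<longlonglongrightarrow> Xs m i j" for m i j by metis
  have XsU: "Xs m \<in> unitri_nonneg n" for m
  proof -
    have "Xs m (i + int n) (j + int n) = Xs m i j" for i j
    proof (rule LIMSEQ_unique[OF Xs])
      have "(\<lambda>k. T m k (i + int n) (j + int n)) = (\<lambda>k. T m k i j)"
        using TU by (simp add: unitri_nonneg_def)
      thus "(\<lambda>k. T m k (i + int n) (j + int n)) \<longlonglongrightarrow> Xs m i j" using Xs by simp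
    qed
    moreover have "Xs m i i = 1" for i
      using Xs[of m i i] unitri_nonnegD(1)[OF TU] by (simp add: LIMSEQ_const_iff)
    moreover have "Xs m i j = 0" if "j < i" for i j
      using Xs[of m i j] unitri_nonnegD(2)[OF TU that] by (simp add: LIMSEQ_const_iff)
    moreover have "0 \<le> Xs m i j" for i j
      by (rule LIMSEQ_le_const[OF Xs]) (simp add: unitri_nonnegD(3)[OF TU])
    ultimately show ?thesis by (simp add: unitri_nonneg_def)
  qed
  have eq: "Xs m = chevalley n (w (Suc m)) (a (Suc m)) \<otimes>\<^bsub>loop_mats n\<^esub> Xs (Suc m)" for m
  proof (intro ext)
    fix i j
    have "(\<lambda>k. T (Suc m) k i j + (if i mod int n = w (Suc m) mod int n then a (Suc m) * T (Suc m) k (i + 1) j else 0))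
      \<longlonglongrightarrow> Xs (Suc m) i j + (if i mod int n = w (Suc m) mod int n then a (Suc m) * Xs (Suc m) (i + 1) j else 0)"
      by (cases "i mod int n = w (Suc m) mod int n") (auto intro!: tendsto_intros Xs)
    hence lim_c: "(\<lambda>k. (c (Suc m) \<otimes>\<^bsub>loop_mats n\<^esub> T (Suc m) k) i j) \<longlonglongrightarrow>
      (chevalley n (w (Suc m)) (a (Suc m)) \<otimes>\<^bsub>loop_mats n\<^esub> Xs (Suc m)) i j"
      by (simp only: c_def chevalley_mult[OF unitri_nonneg_carrier[OF TU]]
          chevalley_mult[OF unitri_nonneg_carrier[OF XsU]])
    have "eventually (\<lambda>k. (c (Suc m) \<otimes>\<^bsub>loop_mats n\<^esub> T (Suc m) k) i j = T m k i j) sequentially"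
      using eventually_gt_at_top[of m] by eventually_elim (simp add: T_left)
    from LIMSEQ_unique[OF Xs iffD1[OF tendsto_cong[OF this] lim_c]]
    show "Xs m i j = (chevalley n (w (Suc m)) (a (Suc m)) \<otimes>\<^bsub>loop_mats n\<^esub> Xs (Suc m)) i j" .
  qed
  have Xs0: "Xs 0 = X" by (intro ext LIMSEQ_unique[OF Xs T0])
  have X_split: "X = T 0 m \<otimes>\<^bsub>loop_mats n\<^esub> Xs m" for m
  proof (induction m)
    case 0
    show ?case by (simp add: T_def list_prod_Nil Xs0[symmetric]
        monoid.l_one[OF monoid_loop_mats unitri_nonneg_carrier[OF XsU]])
  next
    case (Suc m)
    have "T 0 (Suc m) \<otimes>\<^bsub>loop_mats n\<^esub> Xs (Suc m) = T 0 m \<otimes>\<^bsub>loop_mats n\<^esub> (c (Suc m) \<otimes>\<^bsub>loop_mats n\<^esub> Xs (Suc m))"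
      unfolding T_right[OF le0]
      by (intro loop_mats_mult_assoc unitri_nonneg_carrier TU cU XsU) simp
    also have "\<dots> = X" using Suc eq[of m] by (simp only: c_def)
    finally show ?case by simp
  qed
  have "(\<lambda>m. Xs m i j) \<longlonglongrightarrow> \<one>\<^bsub>loop_mats n\<^esub> i j" for i j
  proof (cases "i < j")
    case True
    \<comment> \<open>The tail is at most what the prefix \<open>T 0 m\<close> still misses of
      \<open>X\<close>, and that tends to 0.\<close>
    have le: "Xs m i j \<le> X i j - T 0 m i j" for m
      using unitri_mult_ge_sum[OF TU XsU True, of 0 m m] X_split[of m] by simp
    have "(\<lambda>m. X i j - T 0 m i j) \<longlonglongrightarrow> 0"
      using tendsto_diff[OF tendsto_const T0, of "X i j" i j] by simp
    from tendsto_sandwich[OF _ _ tendsto_const this]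
    have "(\<lambda>m. Xs m i j) \<longlonglongrightarrow> 0"
      using unitri_nonnegD(3)[OF XsU] le by (simp add: always_eventually)
    thus ?thesis using True by (simp add: loop_mats_one)
  next
    case False
    thus ?thesis using unitri_nonnegD(1,2)[OF XsU] by (cases "i = j") (simp_all add: loop_mats_one)
  qed
  moreover have "0 \<le> a (Suc m)" for m by (rule a) simp
  ultimately have "factor_chain n (\<lambda>m. w (Suc m)) (\<lambda>m. a (Suc m)) Xs"
    unfolding factor_chain_def entrywise_lim_def using XsU eq by blast
  with Xs0 show ?thesis by blast
qed

text \<open>Induction on the distance from the diagonal: some later factor has a letter congruent to
  \<open>i\<close> and adds to row \<open>i\<close> a positive multiple of row \<open>i + 1\<close>
  of the tail behind it. Earlier tails dominate later ones, so positivity is inherited.\<close>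

lemma factor_chain_infinite_support:
  assumes ch: "factor_chain n w a Xs"
    and pos: "\<And>m. 0 < a m" and rec: "\<And>r m. \<exists>l\<ge>m. w l mod int n = r mod int n"
  shows "\<not> finitely_supported (Xs 0)"
proof -
  note U = factor_chainD(1)[OF ch]
  note row = chevalley_mult[OF unitri_nonneg_carrier[OF U]]
  have mono: "Xs (m + k) i j \<le> Xs m i j" for m k i j
  proof (induction k)
    case (Suc k)
    have "Xs (Suc (m + k)) i j \<le> Xs (m + k) i j"
      unfolding factor_chainD(3)[OF ch, of "m + k"]
      by (rule unitri_mult_ge_right[OF chevalley_unitri_nonneg[OF factor_chainD(2)[OF ch]] U])
    with Suc show ?case by simp
  qed simp
  have gt: "0 < Xs m i (i + int d)" for m i d
  proof (induction d arbitrary: m i)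
    case 0
    show ?case by (simp add: unitri_nonnegD(1)[OF U])
  next
    case (Suc d)
    from rec obtain l where l: "l \<ge> m" "w l mod int n = i mod int n" by blast
    have "0 < a l * Xs (Suc l) (i + 1) (i + 1 + int d)"
      using Suc pos by simp
    also have "\<dots> \<le> Xs l i (i + int (Suc d))"
      unfolding factor_chainD(3)[OF ch, of l] row
      using l(2) unitri_nonnegD(3)[OF U, of "Suc l" i "i + int (Suc d)"] by (simp add: algebra_simps)
    also have "\<dots> \<le> Xs m i (i + int (Suc d))"
      using mono[of m "l - m"] l(1) by simp
    finally show ?case .
  qed
  show ?thesis
  proof
    assume "finitely_supported (Xs 0)"
    then obtain d where "\<And>i j. j - i > d \<Longrightarrow> Xs 0 i j = 0"
      unfolding finitely_supported_def by blast
    \<comment> \<open>The bound \<open>d\<close> may be negative, hence the absolute value; the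
      added 1 makes the inequality strict.\<close>
    hence "Xs 0 0 (0 + int (nat \<bar>d\<bar> + 1)) = 0" by simp
    with gt[of 0 0 "nat \<bar>d\<bar> + 1"] show False by linarith
  qed
qed

theorem theorem7p7:
  fixes n :: nat and X :: loop_mat and Y N :: "nat \<Rightarrow> loop_mat"
  assumes "n \<ge> 2"
    and "X \<in> Omega n"
    and "Y 0 = X"
    and "\<And>k. k \<ge> 1 \<Longrightarrow> N k = curl n (asw_eps (Y (k - 1)))"
    and "\<And>k. k \<ge> 1 \<Longrightarrow> Y k = inv\<^bsub>loop_mats n\<^esub> (N k) \<otimes>\<^bsub>loop_mats n\<^esub> Y (k - 1)"
  shows "entrywise_lim (\<lambda>k. list_prod n (map N [1..<Suc k])) X"
proof -
  have n1: "n \<ge> 1" using assms(1) by simp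
  from assms(2) obtain w a where red: "infinite_reduced_word n w" and a: "a \<in> l1_pos"
    and lim: "entrywise_lim (\<lambda>k. list_prod n (map (\<lambda>m. chevalley n (w m) (a m)) [1..<Suc k])) X"
    unfolding Omega_def by blast
  have pos: "0 < a k" if "k \<ge> 1" for k using a that by (auto simp: l1_pos_def)
  obtain Xs where Xs0: "Xs 0 = X" and ch: "factor_chain n (\<lambda>m. w (Suc m)) (\<lambda>m. a (Suc m)) Xs"
    using infinite_product_factor_chain[OF less_imp_le[OF pos] lim] by blast
  have inf: "\<not> finitely_supported (Xs 0)"
  proof (rule factor_chain_infinite_support[OF ch])
    show "0 < a (Suc m)" for m by (rule pos) simp
    show "\<exists>l\<ge>m. w (Suc l) mod int n = r mod int n" for r m
    proof -
      obtain l where "l > m" "w l mod int n = r mod int n"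
        using reduced_word_letter_recurs[OF n1 red] by blast
      \<comment> \<open>Factor \<open>m\<close> of the chain carries letter \<open>m + 1\<close> of
        the word, which explains the shift by one.\<close>
      thus ?thesis by (intro exI[of _ "l - 1"]) auto
    qed
  qed
  note iter = funpow_asw_remainder_le[OF assms(1) ch inf]
  have Y: "Y k = (asw_remainder ^^ k) (Xs 0)" for k
  proof (induction k)
    case 0
    show ?case by (simp add: Xs0 assms(3))
  next
    case (Suc k)
    have "Y (Suc k) = inv\<^bsub>loop_mats n\<^esub> (curl n (asw_eps (Y k))) \<otimes>\<^bsub>loop_mats n\<^esub> Y k"
      using assms(4,5)[of "Suc k"] by simp
    also have "\<dots> = asw_remainder (Y k)"
      by (rule inv_curl_asw_eps_mult[OF n1]) (simp add: Suc iter(1))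
    finally show ?case using Suc by simp
  qed
  \<comment> \<open>Each \<open>asw_eps (Y k)\<close> is thus a genuine limit with nonnegative
    values, which makes the curls nonnegative.\<close>
  have Y_tnn: "Y k \<in> tnn2_infinite n" for k unfolding Y by (rule iter(1))
  note YU = tnn2_infiniteD(1)[OF Y_tnn]
  have NU: "N k \<in> unitri_nonneg n" if "k \<ge> 1" for k
    unfolding assms(4)[OF that] by (rule curl_unitri_nonneg[OF asw_eps_nonneg[OF n1 Y_tnn]])
  define P where "P = (\<lambda>k. list_prod n (map N [1..<Suc k]))"
  have PU: "P k \<in> unitri_nonneg n" for k
    unfolding P_def by (rule list_prod_unitri_nonneg) (use NU in auto)
  have "X = P k \<otimes>\<^bsub>loop_mats n\<^esub> Y k" for k
  proof (induction k)
    case 0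
    show ?case using unitri_nonneg_carrier[OF YU, of 0]
      by (simp add: P_def list_prod_Nil assms(3) monoid.l_one[OF monoid_loop_mats])
  next
    case (Suc k)
    have N: "N (Suc k) \<in> carrier (loop_mats n)" by (intro unitri_nonneg_carrier NU) simp
    have "P (Suc k) = P k \<otimes>\<^bsub>loop_mats n\<^esub> list_prod n [N (Suc k)]"
    proof -
      have "[1..<Suc (Suc k)] = [1..<Suc k] @ [Suc k]" by simp
      moreover have "set (map N [1..<Suc k]) \<subseteq> carrier (loop_mats n)"
        using unitri_nonneg_carrier[OF NU] by auto
      ultimately show ?thesis using N unfolding P_def
        by (simp only: map_append list.map) (simp add: list_prod_append del: upt_Suc)
    qed
    also have "list_prod n [N (Suc k)] = N (Suc k)"
      using N by (simp add: list_prod_Cons list_prod_Nil monoid.r_one[OF monoid_loop_mats])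
    finally have "P (Suc k) \<otimes>\<^bsub>loop_mats n\<^esub> Y (Suc k) =
        P k \<otimes>\<^bsub>loop_mats n\<^esub> (N (Suc k) \<otimes>\<^bsub>loop_mats n\<^esub> Y (Suc k))"
      using loop_mats_mult_assoc[OF unitri_nonneg_carrier[OF PU] N unitri_nonneg_carrier[OF YU]] by simp
    also have "N (Suc k) \<otimes>\<^bsub>loop_mats n\<^esub> Y (Suc k) = Y k"
      using assms(4,5)[of "Suc k"] curl_mult_inv_curl_mult[OF unitri_nonneg_carrier[OF YU[of k]]]
      by simp
    finally show ?case using Suc by simp
  qed
  moreover have "entrywise_lim Y \<one>\<^bsub>loop_mats n\<^esub>"
    unfolding entrywise_lim_def
  proof (intro allI)
    fix i j
    show "(\<lambda>k. Y k i j) \<longlonglongrightarrow> \<one>\<^bsub>loop_mats n\<^esub> i j"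
    proof (cases "i = j")
      case True
      thus ?thesis by (simp add: unitri_nonnegD(1)[OF YU] loop_mats_one)
    next
      case False
      have lim0: "(\<lambda>k. Xs k i j) \<longlonglongrightarrow> 0"
        using factor_chainD(4)[OF ch, unfolded entrywise_lim_def, rule_format, of i j] False
        by (simp add: loop_mats_one)
      have "(\<lambda>k. Y k i j) \<longlonglongrightarrow> 0"
      proof (rule tendsto_sandwich[OF _ _ tendsto_const lim0])
        show "\<forall>\<^sub>F k in sequentially. 0 \<le> Y k i j" by (simp add: unitri_nonnegD(3)[OF YU])
        \<comment> \<open>The comparison is used at tail index 0: \<open>k\<close> remainders
          correspond to \<open>k\<close> dropped factors, and the tails tend to the
          identity.\<close>
        have "Y k i j \<le> Xs k i j" for k
          using iter(2)[of k 0 i j] by (simp only: Y add_0)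
        thus "\<forall>\<^sub>F k in sequentially. Y k i j \<le> Xs k i j" by (rule always_eventually[OF allI])
      qed
      thus ?thesis using False by (simp add: loop_mats_one)
    qed
  qed
  ultimately have "entrywise_lim P X" by (rule entrywise_lim_left_factor[OF PU YU])
  thus ?thesis by (simp only: P_def)
qed

end
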